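(* Let $A,E\in\mathbb{R}^{n\times m}$, $\widetilde A=A+E$, $1\le r<\min\{n,m\}$, and let $U_1\Sigma_1$ and $\widetilde U_1\widetilde\Sigma_1$ be the rank-$r$ PCA embeddings of $A$ and $\widetilde A$. Then \[\min_{Q\in\mathbb{O}_r}\|U_1\Sigma_1-\widetilde U_1\widetilde\Sigma_1Q\|\le 3\|E\|+3\sigma_{r+1}\min\Big\{\frac{2\|E\|}{\sigma_r-\sigma_{r+1}},1\Big\},\] \[\min_{Q\in\mathbb{O}_r}\|U_1\Sigma_1-\widetilde U_1\widetilde\Sigma_1Q\|_F\le\Big(2\|E_r\|_F^2+3\Big(\|E_r\|_F+\|(\Sigma_2)_r\|_F\,\mu\Big)^2\Big)^{1/2}+\|E_r\|_F+\|(\Sigma_2)_r\|_F\,\mu,\] where $\mu=\min\{\frac{2\|E\|}{\sigma_r-\sigma_{r+1}},1\}$ and the minima are interpreted as $1$ when $\sigma_r=\sigma_{r+1}$.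
   Context: $A=U\Sigma V^T$ and $\widetilde A=\widetilde U\widetilde\Sigma\widetilde V^T$ are SVDs with singular values $\sigma_1\ge\sigma_2\ge\dots$ of $A$ in nonincreasing order; $U_1,\widetilde U_1\in\mathbb{R}^{n\times r}$ hold the leading $r$ left singular vectors, and $\Sigma_1,\widetilde\Sigma_1$ are the $r\times r$ diagonal matrices of the $r$ largest singular values of $A$, $\widetilde A$. $\mathbb{O}_r$ is the set of $r\times r$ orthogonal matrices. For a matrix $M$, $M_r$ denotes its rank-$r$ hard thresholding (all but the $r$ largest singular values set to $0$). $\Sigma_2$ is the (rectangular) diagonal matrix with diagonal $\sigma_{r+1},\dots,\sigma_{\min\{n,m\}}$, so $\|(\Sigma_2)_r\|_F^2=\sum_{k=1}^r\sigma_{r+k}^2$ (with $\sigma_i=0$ for $i>\min\{n,m\}$). $\|\cdot\|$ is the spectral norm and $\|\cdot\|_F$ the Frobenius norm. *)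

theory Defs
  imports Complex_Main "Jordan_Normal_Form.Matrix"
begin

definition vnorm :: "real vec \<Rightarrow> real" where
  "vnorm v = sqrt (\<Sum>i<dim_vec v. (v $ i)^2)"

definition spec_norm :: "real mat \<Rightarrow> real" where
  "spec_norm M = Sup {vnorm (M *\<^sub>v v) | v. v \<in> carrier_vec (dim_col M) \<and> vnorm v \<le> 1}"

definition frob_norm :: "real mat \<Rightarrow> real" where
  "frob_norm M = sqrt (\<Sum>i<dim_row M. \<Sum>j<dim_col M. (M $$ (i,j))^2)"

definition orth_mats :: "nat \<Rightarrow> real mat set" where
  "orth_mats k = {Q. Q \<in> carrier_mat k k \<and> transpose_mat Q * Q = 1\<^sub>m k}"

definition is_svd :: "real mat \<Rightarrow> real mat \<Rightarrow> real mat \<Rightarrow> real mat \<Rightarrow> bool" where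
  "is_svd A U S V \<longleftrightarrow>
     U \<in> orth_mats (dim_row A) \<and> V \<in> orth_mats (dim_col A) \<and>
     S \<in> carrier_mat (dim_row A) (dim_col A) \<and>
     (\<forall>i<dim_row A. \<forall>j<dim_col A. i \<noteq> j \<longrightarrow> S $$ (i,j) = 0) \<and>
     (\<forall>i<min (dim_row A) (dim_col A). 0 \<le> S $$ (i,i)) \<and>
     (\<forall>i j. i \<le> j \<longrightarrow> j < min (dim_row A) (dim_col A) \<longrightarrow> S $$ (j,j) \<le> S $$ (i,i)) \<and>
     A = U * S * transpose_mat V"

(* rank-r hard thresholding: keep the r largest singular values, zero the rest
   (computed from some SVD of M; its Frobenius norm does not depend on the choice) *)
definition hard_threshold :: "nat \<Rightarrow> real mat \<Rightarrow> real mat" where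
  "hard_threshold r M =
     (let (U,S,V) = (SOME (U,S,V). is_svd M U S V)
      in U * mat (dim_row M) (dim_col M) (\<lambda>(i,j). if i = j \<and> i < r then S $$ (i,j) else 0)
           * transpose_mat V)"

definition lead_cols :: "nat \<Rightarrow> real mat \<Rightarrow> real mat" where
  "lead_cols r U = mat (dim_row U) r (\<lambda>(i,j). U $$ (i,j))"

definition lead_block :: "nat \<Rightarrow> real mat \<Rightarrow> real mat" where
  "lead_block r S = mat r r (\<lambda>(i,j). S $$ (i,j))"

definition trail_block :: "nat \<Rightarrow> real mat \<Rightarrow> real mat" where
  "trail_block r S = mat (dim_row S - r) (dim_col S - r) (\<lambda>(i,j). S $$ (i+r,j+r))"

end

theory Submission
  imports Defs "HOL-Analysis.L2_Norm" "HOL-Analysis.Function_Topology" "Jordan_Normal_Form.Determinant"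
begin

text \<open>Write \<open>B = A + E\<close>, \<open>X = A V\<^sub>1\<close> and \<open>Y = B W\<^sub>1\<close> for the embeddings and
  \<open>G = V\<^sub>1\<^sup>T W\<^sub>1\<close>, where \<open>V\<^sub>1, V\<^sub>2\<close> and \<open>W\<^sub>1, W\<^sub>2\<close> are the leading and trailing right
  singular vectors of \<open>A\<close> and \<open>B\<close>. Let \<open>Q\<close> be the orthogonal polar factor of \<open>G\<^sup>T\<close>. Then
  \<open>Y - X Q\<^sup>T = (Y - X G) + X (G - Q\<^sup>T)\<close>. The first summand equals
  \<open>E W\<^sub>1 + U\<^sub>2 \<Sigma>\<^sub>2 V\<^sub>2\<^sup>T W\<^sub>1\<close>. The second one is dominated by \<open>W\<^sub>2\<^sup>T V\<^sub>1 X\<^sup>T\<close>,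
  because \<open>1 - cos \<theta> \<le> sin \<theta>\<close> for the canonical angles, and
  \<open>W\<^sub>2\<^sup>T V\<^sub>1 X\<^sup>T = W\<^sub>2\<^sup>T (B - E)\<^sup>T U\<^sub>1 U\<^sub>1\<^sup>T\<close>. In the spectral norm the bounds follow from
  Weyl's inequality and Wedin's sine theorem. In the Frobenius norm Ky Fan's maximum principle gives
  \<open>\<parallel>W\<^sub>2\<^sup>T B\<^sup>T U\<^sub>1\<parallel> \<le> \<parallel>U\<^sub>2\<^sup>T B W\<^sub>1\<parallel>\<close>, which is again controlled by \<open>E\<close> and \<open>\<Sigma>\<^sub>2\<close>.\<close>

section \<open>Matrix algebra with dimension side conditions\<close>

text \<open>The laws of this group carry equations between dimensions in place of carrier sets. Once
  the dimensions of all blocks are simplification rules, these side conditions discharge themselves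
  while long products are rearranged.\<close>

lemma assoc_mult_mat_dim:
  "dim_col A = dim_row B \<Longrightarrow> dim_col B = dim_row C \<Longrightarrow> A * B * C = A * (B * C)"
  by (rule assoc_mult_mat[of A "dim_row A" "dim_row B" B "dim_row C" C "dim_col C"]) auto

lemma assoc_mult_mat_vec_dim:
  "dim_col A = dim_row B \<Longrightarrow> dim_col B = dim_vec v \<Longrightarrow> A * B *\<^sub>v v = A *\<^sub>v (B *\<^sub>v v)"
  by (rule assoc_mult_mat_vec[OF carrier_matI carrier_matI carrier_vecI]) auto

lemma transpose_mult_dim:
  fixes A :: "'a::comm_semiring_0 mat"
  shows "dim_col A = dim_row B \<Longrightarrow> transpose_mat (A * B) = transpose_mat B * transpose_mat A"
  by (rule transpose_mult[of A "dim_row A" "dim_row B" B "dim_col B"]) auto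

lemma mult_add_mat_dim:
  assumes "dim_col A = dim_row B" "dim_row B = dim_row C" "dim_col B = dim_col C"
  shows "A * (B + C) = A * B + A * C"
  by (rule mult_add_distrib_mat[of A "dim_row A" "dim_row B" B "dim_col B" C]) (use assms in auto)

lemma add_mult_mat_dim:
  assumes "dim_row A = dim_row B" "dim_col A = dim_col B" "dim_col B = dim_row C"
  shows "(A + B) * C = A * C + B * C"
  by (rule add_mult_distrib_mat[of A "dim_row A" "dim_row C" B C "dim_col C"]) (use assms in auto)

lemma mult_minus_mat_dim:
  fixes A :: "'a::ring mat"
  assumes "dim_col A = dim_row B" "dim_row B = dim_row C" "dim_col B = dim_col C"
  shows "A * (B - C) = A * B - A * C"
  by (rule mult_minus_distrib_mat[of A "dim_row A" "dim_row B" B "dim_col B" C]) (use assms in auto)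

lemma transpose_add_dim:
  "dim_row A = dim_row B \<Longrightarrow> dim_col A = dim_col B \<Longrightarrow>
   transpose_mat (A + B) = transpose_mat A + transpose_mat B"
  by (rule transpose_add[of A "dim_row A" "dim_col A" B]) auto

lemma transpose_minus_dim:
  "dim_row A = dim_row B \<Longrightarrow> dim_col A = dim_col B \<Longrightarrow>
   transpose_mat (A - B) = transpose_mat A - transpose_mat B"
  by (rule transpose_minus[of A "dim_row A" "dim_col A" B]) auto

lemma add_mult_mat_vec_dim:
  assumes "dim_row A = dim_row B" "dim_col A = dim_col B" "dim_col B = dim_vec v"
  shows "(A + B) *\<^sub>v v = A *\<^sub>v v + B *\<^sub>v v"
  by (rule add_mult_distrib_mat_vec[OF carrier_matI carrier_matI carrier_vecI]) (use assms in auto)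

lemma col_mult_dim:
  "dim_col A = dim_row B \<Longrightarrow> j < dim_col B \<Longrightarrow> col (A * B) j = A *\<^sub>v col B j"
  by (rule col_mult2[OF carrier_matI carrier_matI]) auto

lemmas mat_dim_simps = assoc_mult_mat_dim assoc_mult_mat_vec_dim transpose_mult_dim
  mult_add_mat_dim add_mult_mat_dim mult_minus_mat_dim transpose_add_dim
  transpose_minus_dim add_mult_mat_vec_dim

lemma mult_mat_vec_scalar_prod:
  fixes M :: "real mat"
  assumes "dim_col M = dim_vec v" "dim_row M = dim_vec w"
  shows "(M *\<^sub>v v) \<bullet> w = v \<bullet> (transpose_mat M *\<^sub>v w)"
proof -
  have "(transpose_mat M *\<^sub>v w) \<bullet> v = w \<bullet> (M *\<^sub>v v)"
    by (rule transpose_vec_mult_scalar) (use assms in \<open>auto intro!: carrier_vecI carrier_matI\<close>)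
  moreover have "(transpose_mat M *\<^sub>v w) \<bullet> v = v \<bullet> (transpose_mat M *\<^sub>v w)"
    by (rule comm_scalar_prod[of _ "dim_vec v"]) (use assms in \<open>auto intro!: carrier_vecI\<close>)
  moreover have "w \<bullet> (M *\<^sub>v v) = (M *\<^sub>v v) \<bullet> w"
    by (rule comm_scalar_prod[of _ "dim_vec w"]) (use assms in \<open>auto intro!: carrier_vecI\<close>)
  ultimately show ?thesis by simp
qed

section \<open>Euclidean norm\<close>

lemma vnorm_eq_L2_set: "vnorm v = L2_set (($) v) {..<dim_vec v}"
  by (simp add: vnorm_def L2_set_def)

lemma vnorm_nonneg [simp]: "0 \<le> vnorm v"
  by (simp add: vnorm_eq_L2_set)

lemma vnorm_sq: "(vnorm v)\<^sup>2 = v \<bullet> v"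
  by (simp add: vnorm_def scalar_prod_def sum_nonneg power2_eq_square atLeast0LessThan)

lemma vnorm_sq_sum: "(vnorm v)\<^sup>2 = (\<Sum>i<dim_vec v. (v $ i)\<^sup>2)"
  by (simp add: vnorm_def sum_nonneg)

lemma vnorm_zero [simp]: "vnorm (0\<^sub>v n) = 0"
  by (simp add: vnorm_def)

lemma vnorm_eq_0D:
  assumes "vnorm v = 0" shows "v = 0\<^sub>v (dim_vec v)"
  using assms by (auto simp: vnorm_eq_L2_set L2_set_eq_0_iff)

lemma vnorm_unit_vec: "j < k \<Longrightarrow> vnorm (unit_vec k j) = 1"
  using vnorm_sq[of "unit_vec k j"] vnorm_nonneg[of "unit_vec k j"] by (simp add: power2_eq_1_iff)

lemma mult_unit_vec_eq_col:
  "j < dim_col M \<Longrightarrow> M *\<^sub>v unit_vec (dim_col M) j = col M j" for M :: "real mat"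
  by (intro eq_vecI) auto

lemma vnorm_smult: "vnorm (c \<cdot>\<^sub>v v) = \<bar>c\<bar> * vnorm v"
  by (simp add: vnorm_def power_mult_distrib sum_distrib_left[symmetric] real_sqrt_mult)

lemma vnorm_triangle:
  assumes "dim_vec v = dim_vec w" shows "vnorm (v + w) \<le> vnorm v + vnorm w"
proof -
  have "vnorm (v + w) = L2_set (\<lambda>i. v $ i + w $ i) {..<dim_vec w}"
    using assms by (simp add: vnorm_def L2_set_def)
  also have "\<dots> \<le> vnorm v + vnorm w"
    using L2_set_triangle_ineq[of "($) v" "($) w"] assms by (simp add: vnorm_eq_L2_set)
  finally show ?thesis .
qed

lemma scalar_prod_le_vnorm:
  assumes "dim_vec v = dim_vec w" shows "\<bar>v \<bullet> w\<bar> \<le> vnorm v * vnorm w"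
proof -
  have "\<bar>v \<bullet> w\<bar> \<le> (\<Sum>i<dim_vec w. \<bar>v $ i\<bar> * \<bar>w $ i\<bar>)"
    unfolding scalar_prod_def atLeast0LessThan abs_mult[symmetric] by (rule sum_abs)
  also have "\<dots> \<le> vnorm v * vnorm w"
    using L2_set_mult_ineq[of "($) v" "($) w"] assms by (simp add: vnorm_eq_L2_set)
  finally show ?thesis .
qed

lemma vnorm_isometry:
  assumes "transpose_mat Q * Q = 1\<^sub>m k" "dim_vec v = k"
  shows "vnorm (Q *\<^sub>v v) = vnorm v"
proof -
  have k: "dim_col Q = k" using arg_cong[OF assms(1), of dim_row] by simp
  have "(vnorm (Q *\<^sub>v v))\<^sup>2 = v \<bullet> (transpose_mat Q * Q *\<^sub>v v)"
    unfolding vnorm_sq using k assms(2) by (subst mult_mat_vec_scalar_prod) (auto simp: mat_dim_simps)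
  also have "\<dots> = (vnorm v)\<^sup>2"
    using assms by (simp add: vnorm_sq one_mult_mat_vec[OF carrier_vecI])
  finally show ?thesis by (simp add: power2_eq_iff_nonneg)
qed

text \<open>Pythagoras: the resolution of the identity is inserted into \<open>v \<bullet> v\<close>
  and one factor of each product is moved across. Later \<open>P\<close> and \<open>Q\<close> hold
  leading and trailing singular vectors.\<close>

lemma vnorm_resolution:
  assumes "P * transpose_mat P + Q * transpose_mat Q = 1\<^sub>m k" "dim_vec v = k"
    and [simp]: "dim_row P = k" "dim_row Q = k"
  shows "(vnorm v)\<^sup>2 = (vnorm (transpose_mat P *\<^sub>v v))\<^sup>2 + (vnorm (transpose_mat Q *\<^sub>v v))\<^sup>2"
proof -
  have *: "v \<bullet> (R * transpose_mat R *\<^sub>v v) = (vnorm (transpose_mat R *\<^sub>v v))\<^sup>2"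
    if "dim_row R = k" for R
    unfolding vnorm_sq using that assms(2)
    by (subst mult_mat_vec_scalar_prod) (auto simp: mat_dim_simps)
  have "(vnorm v)\<^sup>2 = v \<bullet> ((P * transpose_mat P + Q * transpose_mat Q) *\<^sub>v v)"
    using assms by (simp add: vnorm_sq one_mult_mat_vec[OF carrier_vecI])
  also have "\<dots> = v \<bullet> (P * transpose_mat P *\<^sub>v v) + v \<bullet> (Q * transpose_mat Q *\<^sub>v v)"
    using assms(2) by (subst add_mult_mat_vec_dim)
      (auto intro!: scalar_prod_add_distrib[of _ k] intro: carrier_vecI)
  finally show ?thesis by (simp add: *)
qed

section \<open>Spectral and Frobenius norm\<close>

lemma frob_norm_nonneg [simp]: "0 \<le> frob_norm M"
  by (simp add: frob_norm_def sum_nonneg)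

lemma frob_norm_sq: "(frob_norm M)\<^sup>2 = (\<Sum>i<dim_row M. \<Sum>j<dim_col M. (M $$ (i,j))\<^sup>2)"
  by (simp add: frob_norm_def sum_nonneg)

lemma frob_norm_sq_rows: "(frob_norm M)\<^sup>2 = (\<Sum>i<dim_row M. (vnorm (row M i))\<^sup>2)"
  by (simp add: frob_norm_sq vnorm_sq_sum)

lemma frob_norm_sq_cols: "(frob_norm M)\<^sup>2 = (\<Sum>j<dim_col M. (vnorm (col M j))\<^sup>2)"
  unfolding frob_norm_sq by (subst sum.swap) (simp add: vnorm_sq_sum)

lemma frob_norm_transpose [simp]: "frob_norm (transpose_mat M) = frob_norm M"
  unfolding frob_norm_def by (subst sum.swap) simp

lemma frob_norm_uminus [simp]: "frob_norm (- M) = frob_norm M"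
  by (simp add: frob_norm_def)

lemma frob_norm_triangle:
  assumes "dim_row M = dim_row N" "dim_col M = dim_col N"
  shows "frob_norm (M + N) \<le> frob_norm M + frob_norm N"
proof -
  have *: "frob_norm K = L2_set (($$) K) ({..<dim_row K} \<times> {..<dim_col K})" for K
    unfolding frob_norm_def L2_set_def sum.cartesian_product by (simp add: split_def)
  have "frob_norm (M + N) =
      L2_set (\<lambda>p. M $$ p + N $$ p) ({..<dim_row N} \<times> {..<dim_col N})"
    unfolding * L2_set_def by (auto intro!: sum.cong arg_cong[of _ _ sqrt])
  also have "\<dots> \<le> frob_norm M + frob_norm N"
    using L2_set_triangle_ineq[of "($$) M" "($$) N"] assms by (simp add: *)
  finally show ?thesis .
qed

text \<open>Cauchy-Schwarz in every row. The bound shows that the set in the definition of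
  \<open>spec_norm\<close> is bounded above, so that its supremum is a genuine one.\<close>

lemma vnorm_mult_le_frob_norm:
  assumes "dim_vec v = dim_col M"
  shows "vnorm (M *\<^sub>v v) \<le> frob_norm M * vnorm v"
proof (rule power2_le_imp_le)
  have "(vnorm (M *\<^sub>v v))\<^sup>2 = (\<Sum>i<dim_row M. (row M i \<bullet> v)\<^sup>2)"
    by (simp add: vnorm_sq_sum)
  also have "\<dots> \<le> (\<Sum>i<dim_row M. (vnorm (row M i) * vnorm v)\<^sup>2)"
    by (intro sum_mono) (metis abs_ge_zero assms index_row(2) power2_abs power_mono scalar_prod_le_vnorm)
  also have "\<dots> = (frob_norm M * vnorm v)\<^sup>2"
    by (simp add: power_mult_distrib frob_norm_sq_rows sum_distrib_right)
  finally show "(vnorm (M *\<^sub>v v))\<^sup>2 \<le> (frob_norm M * vnorm v)\<^sup>2" .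
qed simp

lemma spec_norm_le:
  assumes "\<And>v. v \<in> carrier_vec (dim_col M) \<Longrightarrow> vnorm (M *\<^sub>v v) \<le> c * vnorm v" "0 \<le> c"
  shows "spec_norm M \<le> c"
  unfolding spec_norm_def
proof (rule cSup_least)
  show "{vnorm (M *\<^sub>v v) |v. v \<in> carrier_vec (dim_col M) \<and> vnorm v \<le> 1} \<noteq> {}"
    by (auto intro!: exI[of _ "0\<^sub>v (dim_col M)"])
  fix x assume "x \<in> {vnorm (M *\<^sub>v v) |v. v \<in> carrier_vec (dim_col M) \<and> vnorm v \<le> 1}"
  then obtain v where v: "v \<in> carrier_vec (dim_col M)" "vnorm v \<le> 1" "x = vnorm (M *\<^sub>v v)" by blast
  have "c * vnorm v \<le> c * 1" using v assms(2) by (intro mult_left_mono)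
  then show "x \<le> c" using assms(1)[OF v(1)] v(3) by simp
qed

lemma vnorm_mult_le:
  assumes v: "dim_vec v = dim_col M"
  shows "vnorm (M *\<^sub>v v) \<le> spec_norm M * vnorm v"
proof (cases "vnorm v = 0")
  case True
  then show ?thesis using vnorm_mult_le_frob_norm[OF v] by simp
next
  case False
  then have pos: "vnorm v > 0" by (simp add: order_less_le)
  let ?B = "{vnorm (M *\<^sub>v v) |v. v \<in> carrier_vec (dim_col M) \<and> vnorm v \<le> 1}"
  have "bdd_above ?B"
  proof (rule bdd_aboveI)
    fix x assume "x \<in> ?B"
    then obtain w where w: "w \<in> carrier_vec (dim_col M)" "vnorm w \<le> 1" "x = vnorm (M *\<^sub>v w)" by blast
    have "frob_norm M * vnorm w \<le> frob_norm M * 1" using w by (intro mult_left_mono) auto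
    then show "x \<le> frob_norm M" using vnorm_mult_le_frob_norm[of w M] w by simp
  qed
  moreover have "vnorm (M *\<^sub>v ((1 / vnorm v) \<cdot>\<^sub>v v)) \<in> ?B"
    using v pos by (auto simp: vnorm_smult intro!: carrier_vecI exI[of _ "(1 / vnorm v) \<cdot>\<^sub>v v"])
  ultimately have "vnorm (M *\<^sub>v ((1 / vnorm v) \<cdot>\<^sub>v v)) \<le> spec_norm M"
    unfolding spec_norm_def by (rule cSup_upper[rotated])
  moreover have "M *\<^sub>v ((1 / vnorm v) \<cdot>\<^sub>v v) = (1 / vnorm v) \<cdot>\<^sub>v (M *\<^sub>v v)"
    by (rule mult_mat_vec) (use v in \<open>auto intro!: carrier_vecI\<close>)
  ultimately show ?thesis using pos by (simp add: vnorm_smult field_simps)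
qed

lemma spec_norm_nonneg [simp]: "0 \<le> spec_norm M"
\<comment> \<open>Without columns there is no unit vector to test with; the set under the supremum
  is then \<open>{0}\<close>.\<close>
proof (cases "dim_col M = 0")
  case True
  then have "{vnorm (M *\<^sub>v v) |v. v \<in> carrier_vec (dim_col M) \<and> vnorm v \<le> 1} = {0}"
    by (auto simp: vnorm_def scalar_prod_def intro!: exI[of _ "0\<^sub>v 0"])
  then show ?thesis by (simp add: spec_norm_def)
next
  case False
  then have "0 \<le> spec_norm M * vnorm (unit_vec (dim_col M) 0)"
    by (intro order_trans[OF vnorm_nonneg vnorm_mult_le]) simp
  with False show ?thesis by (simp add: vnorm_unit_vec)
qed

lemma vnorm_col_le: "j < dim_col M \<Longrightarrow> vnorm (col M j) \<le> spec_norm M"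
  using vnorm_mult_le[of "unit_vec (dim_col M) j" M] by (simp add: mult_unit_vec_eq_col vnorm_unit_vec)

lemma spec_norm_triangle:
  assumes "dim_row M = dim_row N" "dim_col M = dim_col N"
  shows "spec_norm (M + N) \<le> spec_norm M + spec_norm N"
proof (rule spec_norm_le)
  fix v :: "real vec" assume "v \<in> carrier_vec (dim_col (M + N))"
  then have v: "dim_vec v = dim_col M" "dim_vec v = dim_col N" using assms by auto
  have "vnorm ((M + N) *\<^sub>v v) \<le> vnorm (M *\<^sub>v v) + vnorm (N *\<^sub>v v)"
    using v assms by (subst add_mult_mat_vec_dim) (auto intro: vnorm_triangle)
  also have "\<dots> \<le> (spec_norm M + spec_norm N) * vnorm v"
    using vnorm_mult_le[OF v(1)] vnorm_mult_le[OF v(2)] by (simp add: algebra_simps)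
  finally show "vnorm ((M + N) *\<^sub>v v) \<le> (spec_norm M + spec_norm N) * vnorm v" .
qed simp

lemma spec_norm_mult:
  assumes "dim_col M = dim_row N"
  shows "spec_norm (M * N) \<le> spec_norm M * spec_norm N"
proof (rule spec_norm_le)
  fix v :: "real vec" assume "v \<in> carrier_vec (dim_col (M * N))"
  then have v: "dim_vec v = dim_col N" by auto
  have "vnorm (M * N *\<^sub>v v) \<le> spec_norm M * vnorm (N *\<^sub>v v)"
    using v assms by (subst assoc_mult_mat_vec_dim) (auto intro: vnorm_mult_le)
  also have "\<dots> \<le> spec_norm M * (spec_norm N * vnorm v)"
    using vnorm_mult_le[OF v] by (intro mult_left_mono) auto
  finally show "vnorm (M * N *\<^sub>v v) \<le> spec_norm M * spec_norm N * vnorm v" by simp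
qed simp

lemma spec_norm_mult_le:
  assumes "dim_col M = dim_row N" "spec_norm M \<le> a" "spec_norm N \<le> b"
  shows "spec_norm (M * N) \<le> a * b"
  using spec_norm_mult[OF assms(1)] assms(2,3) spec_norm_nonneg
  by (meson mult_mono' order_trans)

lemma spec_norm_uminus [simp]: "spec_norm (- M) = spec_norm M"
proof -
  have "vnorm (- M *\<^sub>v v) = vnorm (M *\<^sub>v v)" if "v \<in> carrier_vec (dim_col M)" for v
    using that by (simp add: vnorm_def)
  then show ?thesis 
    unfolding spec_norm_def by (intro arg_cong[of _ _ Sup] Collect_cong ex_cong1) auto
qed

text \<open>For w = M^T v, Cauchy-Schwarz gives |w|^2 = <M w, v> \<le> |M| |w| |v|, and a factor |w|
  cancels.\<close>

lemma spec_norm_transpose_le: "spec_norm (transpose_mat M) \<le> spec_norm M"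
proof (rule spec_norm_le)
  fix v :: "real vec" assume "v \<in> carrier_vec (dim_col (transpose_mat M))"
  then have v: "dim_vec v = dim_row M" by auto
  let ?w = "transpose_mat M *\<^sub>v v"
  have "vnorm ?w * vnorm ?w = (M *\<^sub>v ?w) \<bullet> v"
    using v by (subst mult_mat_vec_scalar_prod) (auto simp: vnorm_sq[symmetric] power2_eq_square)
  also have "\<dots> \<le> vnorm (M *\<^sub>v ?w) * vnorm v"
    using scalar_prod_le_vnorm[of "M *\<^sub>v ?w" v] v by simp
  also have "\<dots> \<le> spec_norm M * vnorm ?w * vnorm v"
    by (intro mult_right_mono vnorm_mult_le) auto
  finally have "vnorm ?w * vnorm ?w \<le> (spec_norm M * vnorm v) * vnorm ?w" by (simp add: ac_simps)
  then show "vnorm ?w \<le> spec_norm M * vnorm v"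
    by (cases "vnorm ?w = 0") (simp_all add: mult_le_cancel_right order_less_le)
qed simp

lemma spec_norm_transpose [simp]: "spec_norm (transpose_mat M) = spec_norm M"
  using spec_norm_transpose_le[of M] spec_norm_transpose_le[of "transpose_mat M"] by simp

lemma spec_norm_isometry:
  assumes "transpose_mat Q * Q = 1\<^sub>m k" shows "spec_norm Q \<le> 1"
proof -
  have "dim_col Q = k" using arg_cong[OF assms, of dim_row] by simp
  then show ?thesis using vnorm_isometry[OF assms] by (intro spec_norm_le) auto
qed

lemma frob_norm_mult_left:
  assumes "dim_col M = dim_row N"
  shows "frob_norm (M * N) \<le> spec_norm M * frob_norm N"
proof (rule power2_le_imp_le)
  have "(frob_norm (M * N))\<^sup>2 = (\<Sum>j<dim_col N. (vnorm (M *\<^sub>v col N j))\<^sup>2)"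
    using assms by (simp add: frob_norm_sq_cols col_mult_dim)
  also have "\<dots> \<le> (\<Sum>j<dim_col N. (spec_norm M * vnorm (col N j))\<^sup>2)"
    using assms by (intro sum_mono power_mono vnorm_mult_le) auto
  also have "\<dots> = (spec_norm M * frob_norm N)\<^sup>2"
    by (simp add: power_mult_distrib frob_norm_sq_cols sum_distrib_left)
  finally show "(frob_norm (M * N))\<^sup>2 \<le> (spec_norm M * frob_norm N)\<^sup>2" .
qed simp

lemma frob_norm_mult_right:
  assumes "dim_col M = dim_row N"
  shows "frob_norm (M * N) \<le> frob_norm M * spec_norm N"
  using frob_norm_mult_left[of "transpose_mat N" "transpose_mat M"] assms
  by (simp add: transpose_mult_dim[symmetric] mult.commute)

lemma frob_norm_contraction_left:
  "dim_col M = dim_row N \<Longrightarrow> spec_norm M \<le> 1 \<Longrightarrow> frob_norm (M * N) \<le> frob_norm N"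
  using frob_norm_mult_left[of M N] mult_right_mono[of "spec_norm M" 1 "frob_norm N"] by simp

lemma frob_norm_contraction_right:
  "dim_col M = dim_row N \<Longrightarrow> spec_norm N \<le> 1 \<Longrightarrow> frob_norm (M * N) \<le> frob_norm M"
  using frob_norm_mult_right[of M N] mult_left_mono[of "spec_norm N" 1 "frob_norm M"] by simp

lemma frob_norm_isometry:
  assumes "transpose_mat Q * Q = 1\<^sub>m k" "dim_row N = k"
  shows "frob_norm (Q * N) = frob_norm N"
proof -
  have k: "dim_col Q = k" using arg_cong[OF assms(1), of dim_row] by simp
  have "(frob_norm (Q * N))\<^sup>2 = (frob_norm N)\<^sup>2"
    using assms k by (simp add: frob_norm_sq_cols col_mult_dim
        vnorm_isometry[OF assms(1)])
  then show ?thesis by (simp add: power2_eq_iff_nonneg)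
qed

lemma frob_norm_resolution:
  assumes "P * transpose_mat P + Q * transpose_mat Q = 1\<^sub>m k" "dim_row N = k"
    and "dim_row P = k" "dim_row Q = k"
  shows "(frob_norm N)\<^sup>2 = (frob_norm (transpose_mat P * N))\<^sup>2 + (frob_norm (transpose_mat Q * N))\<^sup>2"
  using assms
  by (simp add: frob_norm_sq_cols col_mult_dim sum.distrib[symmetric] vnorm_resolution[OF assms(1)])

section \<open>Existence of singular value decompositions\<close>

text \<open>Fewer than \<open>q\<close> linear conditions leave a nonzero solution: the square
  matrix with the vectors \<open>f i\<close> as first \<open>k\<close> rows and a zero row
  \<open>k\<close> is singular. A kernel vector is then normalised.\<close>

lemma exists_orthogonal_unit_vec:
  fixes f :: "nat \<Rightarrow> real vec"
  assumes "k < q"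
  shows "\<exists>v \<in> carrier_vec q. v \<bullet> v = 1 \<and> (\<forall>i<k. f i \<bullet> v = 0)"
proof -
  \<comment> \<open>The entries of \<open>f i\<close> are copied up to length \<open>q\<close>,
    since \<open>f i\<close> may have any dimension. The product \<open>f i \<bullet> v\<close>
    reads exactly these entries because it sums over the dimension of \<open>v\<close>.\<close>
  let ?M = "mat\<^sub>r q q (\<lambda>i. if i = k then 0\<^sub>v q else vec q (\<lambda>j. if i < k then f i $ j else 0))"
  have "det ?M = 0" by (rule det_row_0) (use assms in auto)
  then obtain v where v: "v \<in> carrier_vec q" "v \<noteq> 0\<^sub>v q" "?M *\<^sub>v v = 0\<^sub>v q"
    by (subst (asm) det_0_iff_vec_prod_zero_field[of _ q]) auto
  have f: "f i \<bullet> v = 0" if "i < k" for i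
  proof -
    have "(?M *\<^sub>v v) $ i = 0" using that assms v(3) by simp
    then show ?thesis using that assms v(1) by (simp add: scalar_prod_def)
  qed
  have n: "vnorm v \<noteq> 0" using vnorm_eq_0D[of v] v by auto
  let ?w = "(1 / vnorm v) \<cdot>\<^sub>v v"
  have "?w \<bullet> ?w = 1" using n by (simp add: vnorm_sq[symmetric] vnorm_smult)
  moreover have "f i \<bullet> ?w = 0" if "i < k" for i
    using f[OF that] by (simp add: scalar_prod_def sum_divide_distrib[symmetric])
  ultimately show ?thesis using v(1) by (intro bexI[of _ ?w]) auto
qed

text \<open>Greedy step towards the singular value decomposition: the norm of the image is
  continuous, and the unit sphere in the orthogonal complement of the vectors \<open>f i\<close> is
  compact and nonempty.\<close>

lemma exists_constrained_maximizer:
  fixes M :: "real mat" and f :: "nat \<Rightarrow> real vec"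
  assumes M: "M \<in> carrier_mat p q" and k: "k < q"
  shows "\<exists>v \<in> carrier_vec q. v \<bullet> v = 1 \<and> (\<forall>i<k. f i \<bullet> v = 0) \<and>
           (\<forall>w \<in> carrier_vec q. w \<bullet> w = 1 \<longrightarrow> (\<forall>i<k. f i \<bullet> w = 0) \<longrightarrow>
              vnorm (M *\<^sub>v w) \<le> vnorm (M *\<^sub>v v))"
proof -
  \<comment> \<open>Vectors become functions on the naturals that vanish from \<open>q\<close> on.
    The box \<open>C\<close> is compact by Tychonoff, \<open>D\<close> is cut out by closed
    equations, and \<open>F\<close> is the squared norm of the image.\<close>
  define C where "C = (PiE UNIV (\<lambda>i. if i < q then {-1..1} else {0}) :: (nat \<Rightarrow> real) set)"
  define D where "D = {g :: nat \<Rightarrow> real. (\<Sum>j<q. g j * g j) = 1} \<inter>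
    (\<Inter>i<k. {g. (\<Sum>j<q. f i $ j * g j) = 0})"
  define F where "F = (\<lambda>g :: nat \<Rightarrow> real. \<Sum>i<p. (\<Sum>j<q. M $$ (i,j) * g j)\<^sup>2)"
  have cont[continuous_intros]: "continuous_on A (\<lambda>g :: nat \<Rightarrow> real. g j)" for A j
    using continuous_on_product_coordinates[of j] continuous_on_subset by blast
  have "compactin (product_topology (\<lambda>_. euclidean) UNIV) C"
    unfolding C_def compactin_PiE by auto
  then have "compact C"
    by (simp add: euclidean_product_topology)
  moreover have "closed D"
    unfolding D_def by (intro closed_Int closed_INT ballI closed_Collect_eq continuous_intros)
  ultimately have comp: "compact (C \<inter> D)" by (rule compact_Int_closed)
  have toD: "(\<lambda>j. if j < q then w $ j else 0) \<in> C \<inter> D"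
    if w: "w \<in> carrier_vec q" "w \<bullet> w = 1" "\<forall>i<k. f i \<bullet> w = 0" for w
  proof -
    have "\<bar>w $ j\<bar> \<le> 1" if "j < q" for j
    proof -
      have "(w $ j)\<^sup>2 \<le> (\<Sum>j<q. (w $ j)\<^sup>2)"
        using that by (intro member_le_sum) auto
      also have "\<dots> = 1" using w by (simp add: scalar_prod_def power2_eq_square atLeast0LessThan)
      finally show ?thesis by (simp add: abs_square_le_1)
    qed
    then show ?thesis
      using w by (auto simp: C_def D_def scalar_prod_def atLeast0LessThan abs_le_iff)
  qed
  have F: "F (\<lambda>j. if j < q then w $ j else 0) = (vnorm (M *\<^sub>v w))\<^sup>2" if "w \<in> carrier_vec q" for w
    using that M by (simp add: F_def vnorm_sq_sum scalar_prod_def atLeast0LessThan)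
  from exists_orthogonal_unit_vec[OF k, of f] toD have ne: "C \<inter> D \<noteq> {}" by fast
  have "continuous_on (C \<inter> D) F" unfolding F_def by (intro continuous_intros)
  from continuous_attains_sup[OF comp ne this]
  obtain g where g: "g \<in> C \<inter> D" and max: "\<And>h. h \<in> C \<inter> D \<Longrightarrow> F h \<le> F g" by blast
  let ?v = "vec q g"
  have "g j = 0" if "\<not> j < q" for j
    using g that by (auto simp: C_def PiE_def Pi_def dest!: spec[of _ j])
  then have gv: "(\<lambda>j. if j < q then ?v $ j else 0) = g" by auto
  have "vnorm (M *\<^sub>v w) \<le> vnorm (M *\<^sub>v ?v)"
    if w: "w \<in> carrier_vec q" "w \<bullet> w = 1" "\<forall>i<k. f i \<bullet> w = 0" for w
  proof (rule power2_le_imp_le)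
    show "(vnorm (M *\<^sub>v w))\<^sup>2 \<le> (vnorm (M *\<^sub>v ?v))\<^sup>2"
      using max[OF toD[OF w]] F[of w] F[of ?v] w(1) gv by simp
  qed simp
  then show ?thesis
    using g by (intro bexI[of _ ?v]) (auto simp: D_def scalar_prod_def atLeast0LessThan)
qed

text \<open>First-order optimality of \<open>v\<close> on the circle spanned by \<open>v\<close> and
  \<open>w\<close>: moving from \<open>v\<close> towards \<open>w\<close> by t changes the squared
  length of the image by a term linear in t, which has to vanish.\<close>

lemma orthogonal_images_of_maximizer:
  fixes M :: "real mat"
  assumes M: "M \<in> carrier_mat p q" and v: "v \<in> carrier_vec q" and w: "w \<in> carrier_vec q"
    and unit: "v \<bullet> v = 1" "w \<bullet> w = 1" "v \<bullet> w = 0"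
    and max: "\<And>a b. a\<^sup>2 + b\<^sup>2 = 1 \<Longrightarrow> vnorm (M *\<^sub>v (a \<cdot>\<^sub>v v + b \<cdot>\<^sub>v w)) \<le> vnorm (M *\<^sub>v v)"
  shows "(M *\<^sub>v v) \<bullet> (M *\<^sub>v w) = 0"
proof -
  define x y where "x = M *\<^sub>v v" and "y = M *\<^sub>v w"
  have xy: "x \<in> carrier_vec p" "y \<in> carrier_vec p" using M v w by (auto simp: x_def y_def)
  have comm: "y \<bullet> x = x \<bullet> y" using xy by (metis comm_scalar_prod)
  have M_lin: "M *\<^sub>v (a \<cdot>\<^sub>v v + b \<cdot>\<^sub>v w) = a \<cdot>\<^sub>v x + b \<cdot>\<^sub>v y" for a b
    unfolding x_def y_def
    using M v w by (simp add: mult_add_distrib_mat_vec[of _ p q] mult_mat_vec[of _ p q])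
  have expand: "(vnorm (a \<cdot>\<^sub>v x + b \<cdot>\<^sub>v y))\<^sup>2 = a\<^sup>2 * (x \<bullet> x) + 2 * a * b * (x \<bullet> y) + b\<^sup>2 * (y \<bullet> y)"
    for a b
    unfolding vnorm_sq using xy comm
    by (simp add: add_scalar_prod_distrib[of _ p] scalar_prod_add_distrib[of _ p]
        algebra_simps power2_eq_square)
  have quad: "2 * t * (x \<bullet> y) \<le> t\<^sup>2 * (x \<bullet> x)" for t
  proof -
    \<comment> \<open>The competitor v + t w is divided by \<open>?s\<close> to return to the
      circle.\<close>
    let ?s = "sqrt (1 + t\<^sup>2)"
    have s: "?s\<^sup>2 = 1 + t\<^sup>2" "?s > 0" by (simp_all add: add_pos_nonneg)
    have "(1 / ?s)\<^sup>2 + (t / ?s)\<^sup>2 = 1"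
      unfolding power_divide s(1) add_divide_distrib[symmetric] using s by simp
    then have "(vnorm ((1 / ?s) \<cdot>\<^sub>v x + (t / ?s) \<cdot>\<^sub>v y))\<^sup>2 \<le> (vnorm x)\<^sup>2"
      using max[of "1 / ?s" "t / ?s"] unfolding M_lin x_def[symmetric] by (intro power_mono) auto
    then have "(x \<bullet> x + 2 * t * (x \<bullet> y) + t\<^sup>2 * (y \<bullet> y)) / ?s\<^sup>2 \<le> x \<bullet> x"
      unfolding expand unfolding vnorm_sq[of x] using s(2) by (simp add: power2_eq_square add_divide_distrib)
    then have "x \<bullet> x + 2 * t * (x \<bullet> y) + t\<^sup>2 * (y \<bullet> y) \<le> (1 + t\<^sup>2) * (x \<bullet> x)"
      using s by (simp add: pos_divide_le_eq mult.commute)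
    moreover have "0 \<le> t\<^sup>2 * (y \<bullet> y)" by (simp add: vnorm_sq[symmetric])
    ultimately show ?thesis by (simp add: algebra_simps)
  qed
  have "0 \<le> x \<bullet> x" by (simp add: vnorm_sq[symmetric])
  \<comment> \<open>Testing \<open>quad\<close> at t = (x.y)/c leaves (x.y)^2 \<le> 0. The summand 1
    keeps the denominator positive when x = 0.\<close>
  define c where "c = x \<bullet> x + 1"
  have c: "c > 0" using \<open>0 \<le> x \<bullet> x\<close> by (simp add: c_def)
  have "2 * (x \<bullet> y / c) * (x \<bullet> y) \<le> (x \<bullet> y / c)\<^sup>2 * c"
    using quad[of "x \<bullet> y / c"] by (simp add: c_def algebra_simps add_increasing)
  then have "(x \<bullet> y)\<^sup>2 \<le> 0" using c by (simp add: power2_eq_square field_simps)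
  then show ?thesis by (simp add: x_def y_def)
qed

text \<open>These are right singular vectors, chosen greedily. The image norms decrease because
  \<open>v k\<close> was already a competitor when \<open>v i\<close> was chosen; the images are
  orthogonal because all unit combinations of \<open>v i\<close> and \<open>v k\<close> were
  competitors too.\<close>

lemma exists_maximizing_sequence:
  fixes M :: "real mat"
  assumes M: "M \<in> carrier_mat p q"
  obtains v where "\<And>k. k < q \<Longrightarrow> v k \<in> carrier_vec q" "\<And>k. k < q \<Longrightarrow> v k \<bullet> v k = 1"
    "\<And>i k. i < k \<Longrightarrow> k < q \<Longrightarrow> v i \<bullet> v k = 0"
    "\<And>i k. i < k \<Longrightarrow> k < q \<Longrightarrow> (M *\<^sub>v v i) \<bullet> (M *\<^sub>v v k) = 0"
    "\<And>i k. i < k \<Longrightarrow> k < q \<Longrightarrow> vnorm (M *\<^sub>v v k) \<le> vnorm (M *\<^sub>v v i)"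
proof -
  \<comment> \<open>The guard \<open>k < q\<close> makes the condition satisfiable for every
    \<open>k\<close>, as the recursive choice over all naturals demands.\<close>
  define P where "P = (\<lambda>f k v. k < q \<longrightarrow> v \<in> carrier_vec q \<and> v \<bullet> v = 1 \<and> (\<forall>i<k. f i \<bullet> v = 0) \<and>
           (\<forall>w \<in> carrier_vec q. w \<bullet> w = 1 \<longrightarrow> (\<forall>i<k. f i \<bullet> w = 0) \<longrightarrow>
              vnorm (M *\<^sub>v w) \<le> vnorm (M *\<^sub>v v)))"
  have "\<exists>f. \<forall>k. P f k (f k)"
  proof (rule dependent_wf_choice[OF wf_less_than])
    show "P f k r = P g k r" if "\<And>z. (z, k) \<in> less_than \<Longrightarrow> f z = g z" for f g k r
      using that by (simp add: P_def)
    show "\<exists>r. P f k r" for f k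
      using exists_constrained_maximizer[OF M, of k f] unfolding P_def by blast
  qed
  then obtain v where v: "\<And>k. P v k (v k)" by blast
  have carrier: "v k \<in> carrier_vec q" and unit: "v k \<bullet> v k = 1" if "k < q" for k
    using v[of k] that by (auto simp: P_def)
  have orth: "v i \<bullet> v k = 0" if "i < k" "k < q" for i k
    using v[of k] that by (auto simp: P_def)
  have orth': "v i \<bullet> v k = 0" if "i \<noteq> k" "i < q" "k < q" for i k
    using orth[of i k] orth[of k i] comm_scalar_prod[OF carrier carrier, of i k] that
    by (metis nat_neq_iff)
  have max: "vnorm (M *\<^sub>v w) \<le> vnorm (M *\<^sub>v v k)"
    if "k < q" "w \<in> carrier_vec q" "w \<bullet> w = 1" "\<And>i. i < k \<Longrightarrow> v i \<bullet> w = 0" for k w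
    using v[of k] that by (auto simp: P_def)
  show ?thesis
  proof (rule that[OF carrier unit orth])
    fix i k :: nat assume ik: "i < k" "k < q"
    then have i: "i < q" by simp
    note car = carrier[OF i] carrier[OF ik(2)]
    have sq: "(a \<cdot>\<^sub>v v i + b \<cdot>\<^sub>v v k) \<bullet> (a \<cdot>\<^sub>v v i + b \<cdot>\<^sub>v v k) = a\<^sup>2 + b\<^sup>2" for a b
      using car unit[OF i] unit[OF ik(2)] orth'[of i k] orth'[of k i] ik i
      by (simp add: add_scalar_prod_distrib[of _ q] scalar_prod_add_distrib[of _ q] power2_eq_square)
    have orth_i: "v l \<bullet> (a \<cdot>\<^sub>v v i + b \<cdot>\<^sub>v v k) = 0" if "l < i" for l a b
    proof -
      have l: "l < q" using that i by simp
      show ?thesis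
        using carrier[OF l] car orth'[of l i] orth'[of l k] that ik i l
        by (simp add: scalar_prod_add_distrib[of _ q])
    qed
    show "vnorm (M *\<^sub>v v k) \<le> vnorm (M *\<^sub>v v i)"
      using ik i car unit orth' by (intro max) auto
    show "(M *\<^sub>v v i) \<bullet> (M *\<^sub>v v k) = 0"
    proof (rule orthogonal_images_of_maximizer[OF M car unit[OF i] unit[OF ik(2)]])
      show "v i \<bullet> v k = 0" using orth ik by simp
      fix a b :: real assume "a\<^sup>2 + b\<^sup>2 = 1"
      then show "vnorm (M *\<^sub>v (a \<cdot>\<^sub>v v i + b \<cdot>\<^sub>v v k)) \<le> vnorm (M *\<^sub>v v i)"
        using car i sq orth_i by (intro max) auto
    qed
  qed
qed

section \<open>Orthogonal matrices and the assembly of the decomposition\<close>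

lemma orth_matsI:
  assumes "\<And>j. j < k \<Longrightarrow> u j \<in> carrier_vec k"
    and "\<And>j. j < k \<Longrightarrow> u j \<bullet> u j = 1" "\<And>i j. i < j \<Longrightarrow> j < k \<Longrightarrow> u i \<bullet> u j = 0"
  shows "mat k k (\<lambda>(i,j). u j $ i) \<in> orth_mats k"
proof -
  have "u i \<bullet> u j = (if i = j then 1 else 0)" if "i < k" "j < k" for i j
    using that assms comm_scalar_prod[OF assms(1) assms(1), of i j] by (metis nat_neq_iff)
  moreover have "vec k (($) (u j)) = u j" if "j < k" for j
    using assms(1)[OF that] by auto
  ultimately have "transpose_mat (mat k k (\<lambda>(i,j). u j $ i)) * mat k k (\<lambda>(i,j). u j $ i) = 1\<^sub>m k"
    by (intro eq_matI) auto
  then show ?thesis by (simp add: orth_mats_def)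
qed

lemma orth_mats_mult_transpose:
  assumes "Q \<in> orth_mats k" shows "Q * transpose_mat Q = 1\<^sub>m k"
  using assms mat_mult_left_right_inverse[of "transpose_mat Q" k Q] by (auto simp: orth_mats_def)

lemma orth_mats_transpose:
  "Q \<in> orth_mats k \<Longrightarrow> transpose_mat Q \<in> orth_mats k"
  using orth_mats_mult_transpose[of Q k] by (simp add: orth_mats_def)

lemma orth_mats_mult:
  assumes "P \<in> orth_mats k" "Q \<in> orth_mats k" shows "P * Q \<in> orth_mats k"
proof -
  have *: "P \<in> carrier_mat k k" "Q \<in> carrier_mat k k" using assms by (auto simp: orth_mats_def)
  then have "transpose_mat (P * Q) * (P * Q) = transpose_mat Q * ((transpose_mat P * P) * Q)"
    by (simp add: mat_dim_simps)
  also have "\<dots> = 1\<^sub>m k" using assms * by (simp add: orth_mats_def)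
  finally show ?thesis using * by (simp add: orth_mats_def)
qed

lemma orth_mats_span:
  assumes "Q \<in> orth_mats k" "v \<in> carrier_vec k" "transpose_mat Q *\<^sub>v v = 0\<^sub>v k"
  shows "v = 0\<^sub>v k"
proof -
  have "v = Q * transpose_mat Q *\<^sub>v v" using orth_mats_mult_transpose[OF assms(1)] assms(2) by simp
  also have "\<dots> = Q *\<^sub>v 0\<^sub>v k" using assms by (auto simp: orth_mats_def mat_dim_simps)
  also have "\<dots> = 0\<^sub>v k" using assms(1) by (intro eq_vecI) (auto simp: orth_mats_def)
  finally show ?thesis .
qed

text \<open>The greedy vectors form \<open>V\<close>, the norms of their images form
  \<open>S\<close>, and the normalised images, completed to an orthonormal basis, form
  \<open>U\<close>. The factorisation is checked column by column as
  \<open>M * V = U * S\<close>.\<close>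

lemma svd_exists: "\<exists>U S V. is_svd M U S V"
proof -
  define p q where "p = dim_row M" and "q = dim_col M"
  have M: "M \<in> carrier_mat p q" by (auto simp: p_def q_def)
  obtain v where v: "\<And>k. k < q \<Longrightarrow> v k \<in> carrier_vec q" "\<And>k. k < q \<Longrightarrow> v k \<bullet> v k = 1"
    "\<And>i k. i < k \<Longrightarrow> k < q \<Longrightarrow> v i \<bullet> v k = 0"
    and orth: "\<And>i k. i < k \<Longrightarrow> k < q \<Longrightarrow> (M *\<^sub>v v i) \<bullet> (M *\<^sub>v v k) = 0"
    and mono: "\<And>i k. i < k \<Longrightarrow> k < q \<Longrightarrow> vnorm (M *\<^sub>v v k) \<le> vnorm (M *\<^sub>v v i)"
    using exists_maximizing_sequence[OF M] by blast
  define s where "s k = vnorm (M *\<^sub>v v k)" for k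
  \<comment> \<open>The left vector is forced when the singular value is nonzero. Otherwise any unit
    vector orthogonal to the earlier ones completes the basis.\<close>
  define P where "P = (\<lambda>f k u. k < p \<longrightarrow> u \<in> carrier_vec p \<and> u \<bullet> u = 1 \<and> (\<forall>i<k. f i \<bullet> u = 0) \<and>
           (k < q \<and> s k \<noteq> 0 \<longrightarrow> u = (1 / s k) \<cdot>\<^sub>v (M *\<^sub>v v k)))"
  have "\<exists>f. \<forall>k. P f k (f k)"
  proof (rule dependent_wf_choice[OF wf_less_than])
    show "P f k r = P g k r" if "\<And>z. (z, k) \<in> less_than \<Longrightarrow> f z = g z" for f g k r
      using that by (simp add: P_def)
    show "\<exists>r. P f k r" if IH: "\<And>i. (i, k) \<in> less_than \<Longrightarrow> P f i (f i)" for f k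
    proof (cases "k < p \<and> k < q \<and> s k \<noteq> 0")
      case False
      then show ?thesis using exists_orthogonal_unit_vec[of k p f] unfolding P_def by blast
    next
      case True
      have pos: "s k > 0" using True by (simp add: s_def order_less_le)
      let ?r = "(1 / s k) \<cdot>\<^sub>v (M *\<^sub>v v k)"
      have "f i \<bullet> ?r = 0" if "i < k" for i
      proof -
        \<comment> \<open>Singular values decrease, so all earlier ones are positive as well and the
          earlier left vectors are themselves normalised images.\<close>
        have "s i > 0" using mono[of i k] pos True that unfolding s_def by linarith
        then have "f i = (1 / s i) \<cdot>\<^sub>v (M *\<^sub>v v i)" using IH[of i] that True by (simp add: P_def)
        then show ?thesis using orth[of i k] that True by simp
      qed
      moreover have "?r \<bullet> ?r = 1" using pos by (simp add: vnorm_sq[symmetric] vnorm_smult s_def)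
      ultimately show ?thesis using M True by (intro exI[of _ ?r]) (auto simp: P_def intro!: carrier_vecI)
    qed
  qed
  then obtain u where u: "\<And>k. P u k (u k)" by blast
  have u1: "u k \<in> carrier_vec p" "u k \<bullet> u k = 1" if "k < p" for k
    using u[of k] that by (auto simp: P_def)
  have u2: "u i \<bullet> u k = 0" if "i < k" "k < p" for i k
    using u[of k] that by (auto simp: P_def)
  have u3: "M *\<^sub>v v k = s k \<cdot>\<^sub>v u k" if "k < p" "k < q" for k
  proof (cases "s k = 0")
    case True
    then show ?thesis using vnorm_eq_0D[of "M *\<^sub>v v k"] M u1(1)[OF that(1)] unfolding s_def
      by (intro eq_vecI) auto
  next
    case False
    then have "u k = (1 / s k) \<cdot>\<^sub>v (M *\<^sub>v v k)" using u[of k] that by (simp add: P_def)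
    then show ?thesis using False by (simp add: smult_smult_assoc)
  qed
  define U where "U = mat p p (\<lambda>(i,j). u j $ i)"
  define V where "V = mat q q (\<lambda>(i,j). v j $ i)"
  define S where "S = mat p q (\<lambda>(i,j). if i = j then s i else 0)"
  have [simp]: "dim_row U = p" "dim_col U = p" "dim_row V = q" "dim_col V = q"
    "dim_row S = p" "dim_col S = q" "dim_row M = p" "dim_col M = q"
    using M by (auto simp: U_def V_def S_def)
  have U: "U \<in> orth_mats p" unfolding U_def by (rule orth_matsI[OF u1 u2])
  have V: "V \<in> orth_mats q" unfolding V_def by (rule orth_matsI[OF v])
  have colV: "col V j = v j" if "j < q" for j using v(1)[OF that] that by (auto simp: V_def)
  have colU: "col U j = u j" if "j < p" for j using u1(1)[OF that] that by (auto simp: U_def)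
  \<comment> \<open>With more columns than rows, the surplus images vanish: each is orthogonal to
    every \<open>u i\<close>, either because \<open>u i\<close> is a multiple of an orthogonal image
    or because \<open>s i = 0\<close> forces the later norm to be 0.\<close>
  have null: "M *\<^sub>v v j = 0\<^sub>v p" if j: "j < q" "p \<le> j" for j
  proof (rule orth_mats_span[OF U])
    show "M *\<^sub>v v j \<in> carrier_vec p" by (auto intro: carrier_vecI)
    have "u i \<bullet> (M *\<^sub>v v j) = 0" if i: "i < p" for i
    proof (cases "s i = 0")
      case True
      then have "vnorm (M *\<^sub>v v j) = 0"
        using mono[of i j] i j vnorm_nonneg[of "M *\<^sub>v v j"] unfolding s_def by linarith
      then have "M *\<^sub>v v j = 0\<^sub>v p" using vnorm_eq_0D by fastforce
      then show ?thesis using u1(1)[OF i] by simp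
    next
      case False
      have "s i * (u i \<bullet> (M *\<^sub>v v j)) = (M *\<^sub>v v i) \<bullet> (M *\<^sub>v v j)"
        using u3[of i] i j u1(1)[OF i] by simp
      also have "\<dots> = 0" using orth i j by simp
      finally show ?thesis using False by simp
    qed
    then show "transpose_mat U *\<^sub>v (M *\<^sub>v v j) = 0\<^sub>v p"
      by (intro eq_vecI) (auto simp: colU)
  qed
  have "M * V = U * S"
  proof (rule eq_matI)
    fix i j assume ij: "i < dim_row (U * S)" "j < dim_col (U * S)"
    have "(U * S) $$ (i,j) = (\<Sum>l<p. u l $ i * (if l = j then s l else 0))"
      using ij by (simp add: scalar_prod_def S_def U_def atLeast0LessThan)
    also have "\<dots> = (if j < p then s j * u j $ i else 0)"
      by (simp add: if_distrib[of "\<lambda>x. _ * x"] sum.delta cong: if_cong)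
    also have "\<dots> = (M *\<^sub>v v j) $ i"
    proof (cases "j < p")
      case True
      then have "M *\<^sub>v v j = s j \<cdot>\<^sub>v u j" using u3 ij by simp
      then show ?thesis using True ij u1(1)[of j] by (simp del: index_mult_mat_vec)
    next
      case False
      then have "M *\<^sub>v v j = 0\<^sub>v p" using null ij by simp
      then show ?thesis using False ij by (simp del: index_mult_mat_vec)
    qed
    also have "\<dots> = (M * V) $$ (i,j)" using ij by (simp add: colV)
    finally show "(M * V) $$ (i,j) = (U * S) $$ (i,j)" by simp
  qed auto
  then have "M * V * transpose_mat V = U * S * transpose_mat V" by simp
  moreover have "M * V * transpose_mat V = M"
    using M by (simp add: mat_dim_simps orth_mats_mult_transpose[OF V])
  ultimately have "M = U * S * transpose_mat V" by simp
  moreover have "s j \<le> s i" if "i \<le> j" "j < q" for i j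
    using mono[of i j] that by (cases "i = j") (auto simp: s_def)
  moreover have "0 \<le> s i" for i by (simp add: s_def)
  ultimately have "is_svd M U S V"
    unfolding is_svd_def using U V by (auto simp: S_def carrier_matI)
  then show ?thesis by blast
qed

section \<open>Diagonal matrices and hard thresholding\<close>

lemma mult_diagonal_index:
  fixes M D :: "real mat"
  assumes "diagonal_mat D" "dim_col M = dim_row D" "i < dim_row M" "j < dim_col D"
  shows "(M * D) $$ (i,j) = (if j < dim_row D then M $$ (i,j) * D $$ (j,j) else 0)"
proof -
  have "(M * D) $$ (i,j) = (\<Sum>l<dim_row D. M $$ (i,l) * D $$ (l,j))"
    using assms by (simp add: scalar_prod_def atLeast0LessThan)
  also have "\<dots> = (\<Sum>l<dim_row D. if l = j then M $$ (i,j) * D $$ (j,j) else 0)"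
    using assms by (intro sum.cong) (auto simp: diagonal_mat_def)
  finally show ?thesis by (simp add: sum.delta)
qed

lemma diagonal_mult_vec_index:
  fixes D :: "real mat"
  assumes "diagonal_mat D" "dim_vec v = dim_col D" "i < dim_row D"
  shows "(D *\<^sub>v v) $ i = (if i < dim_col D then D $$ (i,i) * v $ i else 0)"
proof -
  have "(D *\<^sub>v v) $ i = (\<Sum>l<dim_col D. D $$ (i,l) * v $ l)"
    using assms by (simp add: scalar_prod_def atLeast0LessThan)
  also have "\<dots> = (\<Sum>l<dim_col D. if l = i then D $$ (i,i) * v $ i else 0)"
    using assms by (intro sum.cong) (auto simp: diagonal_mat_def)
  finally show ?thesis by (simp add: sum.delta)
qed

lemma spec_norm_diagonal_le:
  assumes D: "diagonal_mat D" and le: "\<And>i. i < min (dim_row D) (dim_col D) \<Longrightarrow> \<bar>D $$ (i,i)\<bar> \<le> c"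
    and c: "0 \<le> c"
  shows "spec_norm D \<le> c"
proof (rule spec_norm_le[OF _ c])
  fix v :: "real vec" assume "v \<in> carrier_vec (dim_col D)"
  then have v: "dim_vec v = dim_col D" by simp
  let ?l = "min (dim_row D) (dim_col D)"
  show "vnorm (D *\<^sub>v v) \<le> c * vnorm v"
  proof (rule power2_le_imp_le)
    have "(vnorm (D *\<^sub>v v))\<^sup>2 =
        (\<Sum>i<dim_row D. (if i < dim_col D then D $$ (i,i) * v $ i else 0)\<^sup>2)"
      unfolding vnorm_sq_sum using diagonal_mult_vec_index[OF D v]
      by (intro sum.cong) (auto simp del: index_mult_mat_vec)
    also have "\<dots> = (\<Sum>i<?l. (D $$ (i,i) * v $ i)\<^sup>2)"
      by (rule sum.mono_neutral_cong_right) auto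
    also have "\<dots> \<le> (\<Sum>i<?l. (c * v $ i)\<^sup>2)"
    proof (rule sum_mono)
      fix i assume "i \<in> {..<?l}"
      then have "\<bar>D $$ (i,i) * v $ i\<bar> \<le> \<bar>c * v $ i\<bar>"
        using le[of i] c by (auto simp: abs_mult intro!: mult_right_mono)
      then show "(D $$ (i,i) * v $ i)\<^sup>2 \<le> (c * v $ i)\<^sup>2" by (simp add: abs_le_square_iff)
    qed
    also have "\<dots> \<le> (\<Sum>i<dim_col D. (c * v $ i)\<^sup>2)"
      by (rule sum_mono2) auto
    also have "\<dots> = (c * vnorm v)\<^sup>2"
      using v by (simp add: power_mult_distrib vnorm_sq_sum sum_distrib_left)
    finally show "(vnorm (D *\<^sub>v v))\<^sup>2 \<le> (c * vnorm v)\<^sup>2" .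
  qed (use c in simp)
qed

lemma vnorm_diagonal_ge:
  assumes D: "diagonal_mat D" "D \<in> carrier_mat k k" and v: "dim_vec v = k"
    and ge: "\<And>i. i < k \<Longrightarrow> c \<le> D $$ (i,i)" and c: "0 \<le> c"
  shows "c * vnorm v \<le> vnorm (D *\<^sub>v v)"
proof (rule power2_le_imp_le)
  have "(c * vnorm v)\<^sup>2 = (\<Sum>i<k. (c * v $ i)\<^sup>2)"
    using v by (simp add: power_mult_distrib vnorm_sq_sum sum_distrib_left)
  also have "\<dots> \<le> (\<Sum>i<k. (D $$ (i,i) * v $ i)\<^sup>2)"
  proof (rule sum_mono)
    fix i assume "i \<in> {..<k}"
    then have "\<bar>c * v $ i\<bar> \<le> \<bar>D $$ (i,i) * v $ i\<bar>"
      using ge[of i] c by (auto simp: abs_mult intro!: mult_right_mono)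
    then show "(c * v $ i)\<^sup>2 \<le> (D $$ (i,i) * v $ i)\<^sup>2" by (simp add: abs_le_square_iff)
  qed
  also have "\<dots> = (vnorm (D *\<^sub>v v))\<^sup>2"
    unfolding vnorm_sq_sum using diagonal_mult_vec_index[OF D(1), of v] D(2) v
    by (intro sum.cong) (auto simp del: index_mult_mat_vec)
  finally show "(c * vnorm v)\<^sup>2 \<le> (vnorm (D *\<^sub>v v))\<^sup>2" .
qed simp

text \<open>The diagonal matrix is invertible, and its inverse lengthens a vector by at most the
  factor 1/c. Hence \<open>N\<close> is tested through preimages under \<open>D\<close>.\<close>

lemma spec_norm_mult_diagonal_ge:
  assumes D: "diagonal_mat D" "D \<in> carrier_mat k k" and N: "dim_col N = k"
    and ge: "\<And>i. i < k \<Longrightarrow> c \<le> D $$ (i,i)" and c: "0 < c"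
  shows "c * spec_norm N \<le> spec_norm (N * D)"
proof -
  have "spec_norm N \<le> spec_norm (N * D) / c"
  proof (rule spec_norm_le)
    fix v :: "real vec" assume "v \<in> carrier_vec (dim_col N)"
    then have v: "dim_vec v = k" using N by simp
    define w where "w = vec k (\<lambda>i. v $ i / D $$ (i,i))"
    have Dw: "D *\<^sub>v w = v"
    proof (rule eq_vecI)
      fix i assume "i < dim_vec v"
      then show "(D *\<^sub>v w) $ i = v $ i"
        using diagonal_mult_vec_index[OF D(1), of w i] D(2) v ge[of i] c
        by (simp add: w_def del: index_mult_mat_vec)
    qed (use D v in auto)
    have "N * D *\<^sub>v w = N *\<^sub>v (D *\<^sub>v w)"
      using D(2) N by (intro assoc_mult_mat_vec_dim) (auto simp: w_def)
    then have "vnorm (N *\<^sub>v v) = vnorm (N * D *\<^sub>v w)" by (simp only: Dw)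
    also have "\<dots> \<le> spec_norm (N * D) * vnorm w"
      using D(2) by (intro vnorm_mult_le) (simp add: w_def)
    also have "\<dots> \<le> spec_norm (N * D) * (vnorm v / c)"
      using vnorm_diagonal_ge[OF D, of w c] ge c Dw
      by (intro mult_left_mono) (simp_all add: w_def field_simps)
    finally show "vnorm (N *\<^sub>v v) \<le> spec_norm (N * D) / c * vnorm v" by simp
  qed (use c in simp)
  then show ?thesis using c by (simp add: field_simps)
qed

text \<open>Isolates the condition that \<open>is_svd\<close> puts on its middle factor. It survives
  transposition, which reduces statements on left singular vectors to statements on right
  ones.\<close>

definition singular_diag :: "real mat \<Rightarrow> bool" where
  "singular_diag D \<longleftrightarrow> diagonal_mat D \<and>
     (\<forall>i<min (dim_row D) (dim_col D). 0 \<le> D $$ (i,i)) \<and>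
     (\<forall>i j. i \<le> j \<longrightarrow> j < min (dim_row D) (dim_col D) \<longrightarrow> D $$ (j,j) \<le> D $$ (i,i))"

lemma is_svd_iff:
  "is_svd A U S V \<longleftrightarrow> U \<in> orth_mats (dim_row A) \<and> V \<in> orth_mats (dim_col A) \<and>
     S \<in> carrier_mat (dim_row A) (dim_col A) \<and> singular_diag S \<and> A = U * S * transpose_mat V"
  unfolding is_svd_def singular_diag_def diagonal_mat_def by auto

lemma is_svdD:
  assumes "is_svd A U S V"
  shows "A = U * S * transpose_mat V" "singular_diag S"
    "U \<in> orth_mats (dim_row A)" "V \<in> orth_mats (dim_col A)"
    "transpose_mat U * U = 1\<^sub>m (dim_row A)" "transpose_mat V * V = 1\<^sub>m (dim_col A)"
    "dim_row U = dim_row A" "dim_col U = dim_row A" "dim_row V = dim_col A" "dim_col V = dim_col A"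
    "dim_row S = dim_row A" "dim_col S = dim_col A"
proof -
  have U: "U \<in> orth_mats (dim_row A)" and V: "V \<in> orth_mats (dim_col A)"
    and S: "S \<in> carrier_mat (dim_row A) (dim_col A)"
    and "A = U * S * transpose_mat V" "singular_diag S"
    using assms unfolding is_svd_iff by blast+
  then show "A = U * S * transpose_mat V" "singular_diag S"
    "U \<in> orth_mats (dim_row A)" "V \<in> orth_mats (dim_col A)" by blast+
  show "transpose_mat U * U = 1\<^sub>m (dim_row A)" "transpose_mat V * V = 1\<^sub>m (dim_col A)"
    "dim_row U = dim_row A" "dim_col U = dim_row A" "dim_row V = dim_col A" "dim_col V = dim_col A"
    "dim_row S = dim_row A" "dim_col S = dim_col A"
    using U V S by (auto simp: orth_mats_def)
qed

lemma singular_diag_transpose: "singular_diag S \<Longrightarrow> singular_diag (transpose_mat S)"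
  unfolding singular_diag_def diagonal_mat_def by (auto simp: min.commute)

lemma is_svd_transpose:
  assumes "is_svd A U S V" shows "is_svd (transpose_mat A) V (transpose_mat S) U"
proof -
  note D = is_svdD[OF assms]
  have "transpose_mat (U * S * transpose_mat V) = V * transpose_mat S * transpose_mat U"
    using D(7-12) by (simp add: mat_dim_simps)
  then have "transpose_mat A = V * transpose_mat S * transpose_mat U" by (simp only: D(1)[symmetric])
  moreover have "transpose_mat S \<in> carrier_mat (dim_col A) (dim_row A)"
    using D(11,12) by (intro carrier_matI) simp_all
  ultimately show ?thesis
    unfolding is_svd_iff index_transpose_mat(2,3) using D(3,4) singular_diag_transpose[OF D(2)] by blast
qed

text \<open>Combinatorial core of Ky Fan's principle: with total weight at most r K and no weight
  above K, it is best to load the r largest values fully. After subtracting \<open>d r\<close> from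
  all values, terms from index r on are nonpositive and the others are largest at weight K.\<close>

lemma weighted_sum_le_initial_sum:
  fixes d t :: "nat \<Rightarrow> real"
  assumes anti: "\<And>i j. i \<le> j \<Longrightarrow> j < l \<Longrightarrow> d j \<le> d i" and d: "\<And>i. i < l \<Longrightarrow> 0 \<le> d i"
    and t: "\<And>i. i < l \<Longrightarrow> 0 \<le> t i" "\<And>i. i < l \<Longrightarrow> t i \<le> K" and sum: "(\<Sum>i<l. t i) \<le> real r * K"
  shows "(\<Sum>i<l. d i * t i) \<le> K * (\<Sum>i<min r l. d i)"
proof (cases "l \<le> r")
  case True
  then show ?thesis
    using d t by (auto simp: min_absorb2 sum_distrib_left mult.commute[of K] intro!: sum_mono mult_left_mono)
next
  case False
  then have r: "r < l" by simp
  have "(\<Sum>i<l. d i * t i) = (\<Sum>i<l. (d i - d r) * t i) + d r * (\<Sum>i<l. t i)"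
    by (simp add: sum_distrib_left sum.distrib[symmetric] algebra_simps)
  also have "\<dots> \<le> (\<Sum>i<l. if i < r then (d i - d r) * K else 0) + d r * (real r * K)"
  proof (intro add_mono sum_mono mult_left_mono sum d[OF r])
    fix i assume i: "i \<in> {..<l}"
    show "(d i - d r) * t i \<le> (if i < r then (d i - d r) * K else 0)"
    proof (cases "i < r")
      case True
      then show ?thesis using anti[of i r] r t(2)[of i] i by (simp add: mult_left_mono)
    next
      case False
      then show ?thesis using anti[of r i] t(1)[of i] i by (simp add: mult_nonpos_nonneg)
    qed
  qed
  also have "(\<Sum>i<l. if i < r then (d i - d r) * K else 0) = (\<Sum>i<r. (d i - d r) * K)"
    using r by (intro sum.mono_neutral_cong_right) auto
  also have "\<dots> + d r * (real r * K) = K * (\<Sum>i<min r l. d i)"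
    using r by (simp add: min_absorb1 sum_distrib_left sum_subtractf algebra_simps)
  finally show ?thesis .
qed

text \<open>The weights are the squared row norms of \<open>N\<close>. Each is at most the squared
  spectral norm, and their sum is the squared Frobenius norm, which is at most r times it because
  there are at most r columns.\<close>

lemma frob_norm_singular_diag_mult_le:
  assumes D: "singular_diag D" and dim: "dim_col D = dim_row N" "dim_col N \<le> r"
  shows "(frob_norm (D * N))\<^sup>2 \<le>
    (spec_norm N)\<^sup>2 * (\<Sum>i<min r (min (dim_row D) (dim_col D)). (D $$ (i,i))\<^sup>2)"
proof -
  let ?l = "min (dim_row D) (dim_col D)"
  have diag: "diagonal_mat D" using D by (simp add: singular_diag_def)
  define t where "t i = (vnorm (row N i))\<^sup>2" for i
  have DN: "(D * N) $$ (i,j) = (if i < dim_col D then D $$ (i,i) * N $$ (i,j) else 0)"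
    if "i < dim_row D" "j < dim_col N" for i j
    using diagonal_mult_vec_index[OF diag, of "col N j" i] that dim by simp
  have "(frob_norm (D * N))\<^sup>2 =
      (\<Sum>i<dim_row D. \<Sum>j<dim_col N. (if i < dim_col D then D $$ (i,i) * N $$ (i,j) else 0)\<^sup>2)"
    unfolding frob_norm_sq using DN by (intro sum.cong) (auto simp del: index_mult_mat(1))
  also have "\<dots> = (\<Sum>i<?l. (D $$ (i,i))\<^sup>2 * t i)"
    using dim by (intro sum.mono_neutral_cong_right)
      (auto simp: t_def vnorm_sq_sum power_mult_distrib sum_distrib_left min_le_iff_disj)
  also have "\<dots> \<le> (spec_norm N)\<^sup>2 * (\<Sum>i<min r ?l. (D $$ (i,i))\<^sup>2)"
  proof (rule weighted_sum_le_initial_sum)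
    show "(D $$ (j,j))\<^sup>2 \<le> (D $$ (i,i))\<^sup>2" if "i \<le> j" "j < ?l" for i j
      using D that unfolding singular_diag_def by (intro power_mono) auto
    show "t i \<le> (spec_norm N)\<^sup>2" if "i < ?l" for i
    proof -
      have "vnorm (row N i) \<le> spec_norm N"
        using vnorm_col_le[of i "transpose_mat N"] that dim by simp
      then show ?thesis unfolding t_def by (intro power_mono) auto
    qed
    have "(\<Sum>i<?l. t i) \<le> (\<Sum>i<dim_row N. t i)"
      using dim by (intro sum_mono2) (auto simp: t_def)
    also have "\<dots> = (frob_norm N)\<^sup>2" by (simp add: t_def frob_norm_sq_rows)
    also have "\<dots> = (\<Sum>j<dim_col N. (vnorm (col N j))\<^sup>2)" by (rule frob_norm_sq_cols)
    also have "\<dots> \<le> (\<Sum>j<dim_col N. (spec_norm N)\<^sup>2)"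
      by (intro sum_mono power_mono vnorm_col_le) auto
    also have "\<dots> \<le> real r * (spec_norm N)\<^sup>2"
      using dim by (simp add: mult_right_mono)
    finally show "(\<Sum>i<?l. t i) \<le> real r * (spec_norm N)\<^sup>2" .
  qed (auto simp: t_def)
  finally show ?thesis .
qed

text \<open>Brings out the decomposition hidden behind \<open>SOME\<close>, so that later bounds use
  the very one from which the thresholded matrix is built. Orthogonal invariance leaves only the
  retained singular values.\<close>

lemma frob_norm_hard_threshold:
  obtains U S V where "is_svd M U S V"
    "(frob_norm (hard_threshold r M))\<^sup>2 = (\<Sum>i<min r (min (dim_row M) (dim_col M)). (S $$ (i,i))\<^sup>2)"
proof -
  obtain U S V where USV: "(SOME (U,S,V). is_svd M U S V) = (U,S,V)" by (metis prod_cases3)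
  have "\<exists>x. (\<lambda>(U,S,V). is_svd M U S V) x" using svd_exists[of M] by auto
  from someI_ex[OF this] have svd: "is_svd M U S V" using USV by simp
  let ?p = "dim_row M" and ?q = "dim_col M"
  define T where "T = mat ?p ?q (\<lambda>(i,j). if i = j \<and> i < r then S $$ (i,j) else 0)"
  note D = is_svdD[OF svd]
  have T: "dim_row T = ?p" "dim_col T = ?q" by (simp_all add: T_def)
  have "frob_norm (hard_threshold r M) = frob_norm (U * T * transpose_mat V)"
    by (simp add: hard_threshold_def USV T_def)
  also have "\<dots> = frob_norm (V * transpose_mat (U * T))"
    using transpose_mult_dim[of "U * T" "transpose_mat V"] T D(7-10)
      frob_norm_transpose[of "U * T * transpose_mat V"] by simp
  also have "\<dots> = frob_norm T"
    using T D(7-10) by (simp add: frob_norm_isometry[OF D(6)] frob_norm_isometry[OF D(5)])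
  finally have "(frob_norm (hard_threshold r M))\<^sup>2 = (frob_norm T)\<^sup>2" by simp
  also have "\<dots> = (\<Sum>i<?p. \<Sum>j<?q. if i = j then (if i < r then (S $$ (i,i))\<^sup>2 else 0) else 0)"
    unfolding frob_norm_sq by (intro sum.cong) (auto simp: T_def)
  also have "\<dots> = (\<Sum>i<?p. if i < ?q then (if i < r then (S $$ (i,i))\<^sup>2 else 0) else 0)"
    by (simp add: sum.delta')
  also have "\<dots> = (\<Sum>i<min r (min ?p ?q). (S $$ (i,i))\<^sup>2)"
    by (rule sum.mono_neutral_cong_right) auto
  finally show ?thesis using that svd by blast
qed

text \<open>Orthogonal invariance removes \<open>U\<close> and moves \<open>V\<close> into
  \<open>N\<close>, whose spectral norm does not grow. The diagonal case remains.\<close>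

lemma frob_norm_svd_mult_le:
  assumes svd: "is_svd M U S V" and dim: "dim_col M = dim_row N" "dim_col N \<le> r"
  shows "(frob_norm (M * N))\<^sup>2 \<le>
    (spec_norm N)\<^sup>2 * (\<Sum>i<min r (min (dim_row M) (dim_col M)). (S $$ (i,i))\<^sup>2)"
proof -
  let ?p = "dim_row M" and ?q = "dim_col M"
  note D = is_svdD[OF svd]
  have "U * S * transpose_mat V * N = U * (S * (transpose_mat V * N))"
    using D(7-12) dim by (simp add: assoc_mult_mat_dim)
  then have "M * N = U * (S * (transpose_mat V * N))" by (simp only: D(1)[symmetric])
  then have "(frob_norm (M * N))\<^sup>2 = (frob_norm (S * (transpose_mat V * N)))\<^sup>2"
    using D(7-12) by (simp add: frob_norm_isometry[OF D(5)])
  also have "\<dots> \<le> (spec_norm (transpose_mat V * N))\<^sup>2 *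
      (\<Sum>i<min r (min ?p ?q). (S $$ (i,i))\<^sup>2)"
    using frob_norm_singular_diag_mult_le[OF D(2), of "transpose_mat V * N" r] D(7-12) dim by simp
  also have "\<dots> \<le> (spec_norm N)\<^sup>2 * (\<Sum>i<min r (min ?p ?q). (S $$ (i,i))\<^sup>2)"
  proof (intro mult_right_mono power_mono sum_nonneg)
    have "spec_norm (transpose_mat V) \<le> 1"
      using orth_mats_transpose[OF D(4)] by (intro spec_norm_isometry[of _ ?q]) (simp add: orth_mats_def)
    then show "spec_norm (transpose_mat V * N) \<le> spec_norm N"
      using spec_norm_mult_le[of "transpose_mat V" N 1 "spec_norm N"] D(7-12) dim by simp
  qed auto
  finally show ?thesis .
qed

lemma frob_norm_mult_le_hard_threshold:
  assumes dim: "dim_col M = dim_row N" "dim_col N \<le> r"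
  shows "frob_norm (M * N) \<le> frob_norm (hard_threshold r M) * spec_norm N"
proof -
  obtain U S V where svd: "is_svd M U S V" and fr:
    "(frob_norm (hard_threshold r M))\<^sup>2 = (\<Sum>i<min r (min (dim_row M) (dim_col M)). (S $$ (i,i))\<^sup>2)"
    by (rule frob_norm_hard_threshold)
  have "(frob_norm (M * N))\<^sup>2 \<le> (frob_norm (hard_threshold r M) * spec_norm N)\<^sup>2"
    using frob_norm_svd_mult_le[OF svd dim] by (simp add: power_mult_distrib fr mult.commute)
  then show ?thesis by (rule power2_le_imp_le) simp
qed

text \<open>Transposing the decomposition chosen for \<open>M\<close> keeps the hard threshold of
  \<open>M\<close> itself on the right, so no threshold of the transposed matrix enters.\<close>

lemma frob_norm_transpose_mult_le_hard_threshold: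
  assumes dim: "dim_row M = dim_row N" "dim_col N \<le> r"
  shows "frob_norm (transpose_mat M * N) \<le> frob_norm (hard_threshold r M) * spec_norm N"
proof -
  obtain U S V where svd: "is_svd M U S V" and fr:
    "(frob_norm (hard_threshold r M))\<^sup>2 = (\<Sum>i<min r (min (dim_row M) (dim_col M)). (S $$ (i,i))\<^sup>2)"
    by (rule frob_norm_hard_threshold)
  have "(\<Sum>i<min r (min (dim_col M) (dim_row M)). (transpose_mat S $$ (i,i))\<^sup>2) =
      (\<Sum>i<min r (min (dim_row M) (dim_col M)). (S $$ (i,i))\<^sup>2)"
    using is_svdD(11,12)[OF svd] by (intro sum.cong) auto
  then have "(frob_norm (transpose_mat M * N))\<^sup>2 \<le> (frob_norm (hard_threshold r M) * spec_norm N)\<^sup>2"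
    using frob_norm_svd_mult_le[OF is_svd_transpose[OF svd], of N r] dim
    by (simp add: power_mult_distrib fr mult.commute)
  then show ?thesis by (rule power2_le_imp_le) simp
qed

section \<open>Leading and trailing singular subspaces\<close>

definition tail_cols :: "nat \<Rightarrow> real mat \<Rightarrow> real mat" where
  "tail_cols r Q = mat (dim_row Q) (dim_col Q - r) (\<lambda>(i,j). Q $$ (i,j+r))"

lemma dim_blocks [simp]:
  "dim_row (lead_cols r Q) = dim_row Q" "dim_col (lead_cols r Q) = r"
  "dim_row (tail_cols r Q) = dim_row Q" "dim_col (tail_cols r Q) = dim_col Q - r"
  "dim_row (lead_block r S) = r" "dim_col (lead_block r S) = r"
  "dim_row (trail_block r S) = dim_row S - r" "dim_col (trail_block r S) = dim_col S - r"
  by (simp_all add: lead_cols_def tail_cols_def lead_block_def trail_block_def)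

lemma transpose_lead_block:
  "r \<le> dim_row S \<Longrightarrow> r \<le> dim_col S \<Longrightarrow>
   lead_block r (transpose_mat S) = transpose_mat (lead_block r S)"
  by (intro eq_matI) (auto simp: lead_block_def)

lemma transpose_trail_block:
  "trail_block r (transpose_mat S) = transpose_mat (trail_block r S)"
  by (intro eq_matI) (auto simp: trail_block_def)

lemma col_lead_cols: "j < r \<Longrightarrow> r \<le> dim_col Q \<Longrightarrow> col (lead_cols r Q) j = col Q j"
  by (intro eq_vecI) (auto simp: lead_cols_def)

lemma col_tail_cols: "j < dim_col Q - r \<Longrightarrow> col (tail_cols r Q) j = col Q (j + r)"
  by (intro eq_vecI) (auto simp: tail_cols_def)

lemma orth_mats_blocks:
  assumes Q: "Q \<in> orth_mats k" and r: "r \<le> k"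
  shows "transpose_mat (lead_cols r Q) * lead_cols r Q = 1\<^sub>m r"
    and "transpose_mat (tail_cols r Q) * tail_cols r Q = 1\<^sub>m (k - r)"
    and "lead_cols r Q * transpose_mat (lead_cols r Q) +
         tail_cols r Q * transpose_mat (tail_cols r Q) = 1\<^sub>m k"
proof -
  have dims: "dim_row Q = k" "dim_col Q = k" using Q by (auto simp: orth_mats_def)
  have cols: "col Q i \<bullet> col Q j = (if i = j then 1 else 0)" if "i < k" "j < k" for i j
  proof -
    have "(transpose_mat Q * Q) $$ (i,j) = 1\<^sub>m k $$ (i,j)" using Q by (simp add: orth_mats_def)
    then show ?thesis using that dims by simp
  qed
  note [simp] = dims col_lead_cols col_tail_cols
  show "transpose_mat (lead_cols r Q) * lead_cols r Q = 1\<^sub>m r"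
    "transpose_mat (tail_cols r Q) * tail_cols r Q = 1\<^sub>m (k - r)"
    using r by (auto intro!: eq_matI simp: cols)
  show "lead_cols r Q * transpose_mat (lead_cols r Q) +
      tail_cols r Q * transpose_mat (tail_cols r Q) = 1\<^sub>m k"
  proof (rule eq_matI)
    fix i j assume "i < dim_row (1\<^sub>m k :: real mat)" "j < dim_col (1\<^sub>m k :: real mat)"
    then have ij: "i < k" "j < k" by auto
    have "(\<Sum>l<k. Q $$ (i,l) * Q $$ (j,l)) =
        (\<Sum>l<r. Q $$ (i,l) * Q $$ (j,l)) + (\<Sum>l<k - r. Q $$ (i,l+r) * Q $$ (j,l+r))"
      using sum.atLeastLessThan_concat[of 0 r k "\<lambda>l. Q $$ (i,l) * Q $$ (j,l)"] r
        sum.shift_bounds_nat_ivl[of "\<lambda>l. Q $$ (i,l) * Q $$ (j,l)" 0 r "k - r"]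
      by (simp add: atLeast0LessThan)
    moreover have "(\<Sum>l<k. Q $$ (i,l) * Q $$ (j,l)) = (Q * transpose_mat Q) $$ (i,j)"
      using ij by (simp add: scalar_prod_def atLeast0LessThan)
    ultimately show "(lead_cols r Q * transpose_mat (lead_cols r Q) +
      tail_cols r Q * transpose_mat (tail_cols r Q)) $$ (i,j) = 1\<^sub>m k $$ (i,j)"
      using ij orth_mats_mult_transpose[OF Q]
      by (simp add: scalar_prod_def atLeast0LessThan lead_cols_def tail_cols_def)
  qed auto
qed

locale svd_split =
  fixes A U S V :: "real mat" and n m r :: nat
  assumes carrier_A: "A \<in> carrier_mat n m" and svd: "is_svd A U S V" and r_le: "r \<le> min n m"
begin

abbreviation "U1 \<equiv> lead_cols r U"
abbreviation "U2 \<equiv> tail_cols r U"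
abbreviation "V1 \<equiv> lead_cols r V"
abbreviation "V2 \<equiv> tail_cols r V"
abbreviation "S1 \<equiv> lead_block r S"
abbreviation "S2 \<equiv> trail_block r S"

lemma dims [simp]:
  "dim_row A = n" "dim_col A = m" "dim_row U = n" "dim_col U = n" "dim_row V = m" "dim_col V = m"
  "dim_row S = n" "dim_col S = m"
  using is_svdD(7-12)[OF svd] carrier_A by auto

lemma r_bounds: "r \<le> n" "r \<le> m"
  using r_le by auto

lemma orth: "U \<in> orth_mats n" "V \<in> orth_mats m"
  using is_svdD(3,4)[OF svd] by auto

lemmas U_blocks = orth_mats_blocks[OF orth(1) r_bounds(1)]
lemmas V_blocks = orth_mats_blocks[OF orth(2) r_bounds(2)]

lemma spec_norm_blocks: "spec_norm U1 \<le> 1" "spec_norm U2 \<le> 1" "spec_norm V1 \<le> 1" "spec_norm V2 \<le> 1"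
  using U_blocks V_blocks by (auto intro: spec_norm_isometry)

lemma diagonal_S: "diagonal_mat S"
  using is_svdD(2)[OF svd] by (simp add: singular_diag_def)

lemma diagonal_blocks: "diagonal_mat S1" "diagonal_mat S2"
  using diagonal_S r_bounds unfolding diagonal_mat_def by (auto simp: lead_block_def trail_block_def)

lemma S_nonneg: "i < n \<Longrightarrow> i < m \<Longrightarrow> 0 \<le> S $$ (i,i)"
  using is_svdD(2)[OF svd] by (simp add: singular_diag_def)

lemma S_antimono: "i \<le> j \<Longrightarrow> j < n \<Longrightarrow> j < m \<Longrightarrow> S $$ (j,j) \<le> S $$ (i,i)"
  using is_svdD(2)[OF svd] by (simp add: singular_diag_def)

lemma A_mult_V: "A * V = U * S"
proof -
  have "U * S * transpose_mat V * V = U * S"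
    using is_svdD(6)[OF svd] by (simp add: assoc_mult_mat_dim)
  then show ?thesis by (simp only: is_svdD(1)[OF svd, symmetric])
qed

lemma A_mult_V1: "A * V1 = U1 * S1"
proof (rule eq_matI)
  fix i j assume "i < dim_row (U1 * S1)" "j < dim_col (U1 * S1)"
  then have ij: "i < n" "j < r" "j < m" "j < n" using r_bounds by auto
  have "(A * V1) $$ (i,j) = (U * S) $$ (i,j)"
    using ij r_bounds by (simp add: col_lead_cols flip: A_mult_V)
  also have "\<dots> = U $$ (i,j) * S $$ (j,j)"
    using ij by (subst mult_diagonal_index[OF diagonal_S]) auto
  also have "\<dots> = (U1 * S1) $$ (i,j)"
    using ij by (subst mult_diagonal_index[OF diagonal_blocks(1)]) (auto simp: lead_cols_def lead_block_def)
  finally show "(A * V1) $$ (i,j) = (U1 * S1) $$ (i,j)" .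
qed auto

lemma A_mult_V2: "A * V2 = U2 * S2"
proof (rule eq_matI)
  fix i j assume "i < dim_row (U2 * S2)" "j < dim_col (U2 * S2)"
  then have ij: "i < n" "j < m - r" using r_bounds by auto
  have "(A * V2) $$ (i,j) = (U * S) $$ (i,j + r)"
    using ij r_bounds by (simp add: col_tail_cols flip: A_mult_V)
  \<comment> \<open>For n < m the columns of \<open>S\<close> from index n on are zero.\<close>
  also have "\<dots> = (if j + r < n then U $$ (i,j + r) * S $$ (j + r,j + r) else 0)"
    using ij by (subst mult_diagonal_index[OF diagonal_S]) auto
  also have "\<dots> = (U2 * S2) $$ (i,j)"
    using ij by (subst mult_diagonal_index[OF diagonal_blocks(2)]) (auto simp: tail_cols_def trail_block_def)
  finally show "(A * V2) $$ (i,j) = (U2 * S2) $$ (i,j)" .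
qed auto

lemma A_decomp: "A = U1 * S1 * transpose_mat V1 + U2 * S2 * transpose_mat V2"
proof -
  have "A = A * (V1 * transpose_mat V1 + V2 * transpose_mat V2)"
    by (simp add: V_blocks(3))
  also have "\<dots> = A * V1 * transpose_mat V1 + A * V2 * transpose_mat V2"
    by (simp add: mult_add_mat_dim assoc_mult_mat_dim)
  finally show ?thesis by (simp only: A_mult_V1 A_mult_V2)
qed

text \<open>Indices start at 0, so \<open>S $$ (r,r)\<close> is sigma_{r+1}, the largest entry of
  the trailing block.\<close>

lemma spec_norm_S2:
  assumes "r < n" "r < m" shows "spec_norm S2 \<le> S $$ (r,r)"
proof (rule spec_norm_diagonal_le[OF diagonal_blocks(2)])
  fix i assume "i < min (dim_row S2) (dim_col S2)"
  then have i: "i < n - r" "i < m - r" "i + r < n" "i + r < m" by auto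
  then show "\<bar>S2 $$ (i,i)\<bar> \<le> S $$ (r,r)"
    using S_antimono[of r "i + r"] S_nonneg[of "i + r"] by (simp add: trail_block_def)
qed (use assms S_nonneg in simp)

lemma svd_split_transpose: "svd_split (transpose_mat A) V (transpose_mat S) U m n r"
  using carrier_A is_svd_transpose[OF svd] r_le by unfold_locales auto

lemma At_mult_U1: "transpose_mat A * U1 = V1 * transpose_mat S1"
  and At_mult_U2: "transpose_mat A * U2 = V2 * transpose_mat S2"
  using svd_split.A_mult_V1[OF svd_split_transpose] svd_split.A_mult_V2[OF svd_split_transpose]
    transpose_lead_block[of r S] transpose_trail_block[of r S] r_bounds by simp_all

lemma transpose_S1: "transpose_mat S1 = S1"
  using diagonal_blocks(1) by (intro eq_matI) (auto simp: diagonal_mat_def, metis)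

lemma V2t_mult_At: "transpose_mat V2 * transpose_mat A = transpose_mat S2 * transpose_mat U2"
  using arg_cong[OF A_mult_V2, of transpose_mat] by (simp add: transpose_mult_dim)

lemma U2t_mult_A: "transpose_mat U2 * A = S2 * transpose_mat V2"
  using arg_cong[OF At_mult_U2, of transpose_mat] by (simp add: transpose_mult_dim)

text \<open>Ky Fan's maximum principle: a contraction with r columns captures at most the r largest
  squared singular values, and the leading right singular vectors capture exactly these.\<close>

lemma ky_fan_frob_norm:
  assumes "dim_row N = n" "dim_col N = r" "spec_norm N \<le> 1"
  shows "frob_norm (transpose_mat A * N) \<le> frob_norm (A * V1)"
proof (rule power2_le_imp_le)
  have "(\<Sum>i<min r (min m n). (transpose_mat S $$ (i,i))\<^sup>2) = (\<Sum>i<r. (S $$ (i,i))\<^sup>2)"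
    using r_bounds by (simp add: min_absorb1)
  then have "(frob_norm (transpose_mat A * N))\<^sup>2 \<le> (spec_norm N)\<^sup>2 * (\<Sum>i<r. (S $$ (i,i))\<^sup>2)"
    using frob_norm_svd_mult_le[OF is_svd_transpose[OF svd], of N r] assms by simp
  also have "\<dots> \<le> 1 * (\<Sum>i<r. (S $$ (i,i))\<^sup>2)"
    using assms(3) by (intro mult_right_mono sum_nonneg) (auto simp: power_le_one)
  also have "\<dots> = (\<Sum>i<r. \<Sum>j<r. if i = j then (S $$ (i,i))\<^sup>2 else 0)"
    by (simp add: sum.delta')
  also have "\<dots> = (frob_norm S1)\<^sup>2"
    unfolding frob_norm_sq using diagonal_S r_bounds
    by (intro sum.cong) (auto simp: lead_block_def diagonal_mat_def)
  also have "\<dots> = (frob_norm (A * V1))\<^sup>2"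
    by (simp add: A_mult_V1 frob_norm_isometry[OF U_blocks(1)])
  finally show "(frob_norm (transpose_mat A * N))\<^sup>2 \<le> (frob_norm (A * V1))\<^sup>2" .
qed simp

end

section \<open>Perturbation bounds for singular values and subspaces\<close>

lemma spec_norm_minus_commute:
  assumes "dim_row A = dim_row B" "dim_col A = dim_col B"
  shows "spec_norm (A - B) = spec_norm (B - A)"
proof -
  have "A - B = - (B - A)" using assms by (intro eq_matI) auto
  then show ?thesis by simp
qed

text \<open>Min-max argument: some unit vector lies in the span of the leading i + 1 right singular
  vectors of \<open>B\<close> and is orthogonal to the leading i ones of \<open>A\<close>. There
  \<open>B\<close> stretches by at least its (i+1)-st singular value and \<open>A\<close> by at most
  its own.\<close>

lemma weyl_singular_value:
  assumes A: "A \<in> carrier_mat n m" "is_svd A U S V" and B: "B \<in> carrier_mat n m" "is_svd B U' S' V'"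
    and i: "i < n" "i < m"
  shows "S' $$ (i,i) \<le> S $$ (i,i) + spec_norm (B - A)"
proof -
  interpret A: svd_split A U S V n m i using A i by unfold_locales auto
  interpret B: svd_split B U' S' V' n m "Suc i" using B i by unfold_locales auto
  let ?W = "transpose_mat A.V1 * B.V1"
  \<comment> \<open>The coefficients in the span of the columns of \<open>B.V1\<close>: i
    orthogonality conditions on i + 1 unknowns.\<close>
  obtain c where c: "c \<in> carrier_vec (Suc i)" "c \<bullet> c = 1" "\<And>l. l < i \<Longrightarrow> row ?W l \<bullet> c = 0"
    using exists_orthogonal_unit_vec[of i "Suc i" "row ?W"] by auto
  have [simp]: "dim_vec c = Suc i" using c(1) by simp
  have "?W *\<^sub>v c = 0\<^sub>v i"
  proof (rule eq_vecI)
    fix l assume "l < dim_vec (0\<^sub>v i :: real vec)"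
    then have l: "l < i" by simp
    then have "(?W *\<^sub>v c) $ l = row ?W l \<bullet> c" by (intro index_mult_mat_vec) simp
    then show "(?W *\<^sub>v c) $ l = 0\<^sub>v i $ l" using c(3)[OF l] l by simp
  qed simp
  define x where "x = B.V1 *\<^sub>v c"
  have [simp]: "dim_vec x = m" by (simp add: x_def)
  have nc: "vnorm c = 1"
    using c(2) vnorm_nonneg[of c] by (simp add: vnorm_sq[symmetric] power2_eq_1_iff)
  then have nx: "vnorm x = 1" by (simp add: x_def vnorm_isometry[OF B.V_blocks(1)])
  have V1x: "transpose_mat A.V1 *\<^sub>v x = 0\<^sub>v i"
    using \<open>?W *\<^sub>v c = 0\<^sub>v i\<close> by (simp add: x_def assoc_mult_mat_vec_dim)
  have "B *\<^sub>v x = B.U1 *\<^sub>v (B.S1 *\<^sub>v c)"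
    by (simp add: x_def assoc_mult_mat_vec_dim[symmetric] B.A_mult_V1)
  then have "vnorm (B *\<^sub>v x) = vnorm (B.S1 *\<^sub>v c)"
    by (simp add: vnorm_isometry[OF B.U_blocks(1)])
  moreover have "S' $$ (i,i) * vnorm c \<le> vnorm (B.S1 *\<^sub>v c)"
    by (rule vnorm_diagonal_ge[OF B.diagonal_blocks(1)])
       (use i B.S_nonneg B.S_antimono in \<open>auto simp: lead_block_def\<close>)
  ultimately have lower: "S' $$ (i,i) \<le> vnorm (B *\<^sub>v x)" using nc by simp
  have "A *\<^sub>v x = (A.U1 * A.S1 * transpose_mat A.V1 + A.U2 * A.S2 * transpose_mat A.V2) *\<^sub>v x"
    by (simp only: A.A_decomp[symmetric])
  also have "\<dots> = A.U1 * A.S1 *\<^sub>v 0\<^sub>v i + A.U2 * A.S2 * transpose_mat A.V2 *\<^sub>v x"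
    by (simp add: add_mult_mat_vec_dim assoc_mult_mat_vec_dim V1x)
  also have "A.U1 * A.S1 *\<^sub>v 0\<^sub>v i = 0\<^sub>v n"
    by (intro eq_vecI) (auto simp: scalar_prod_def)
  finally have "A *\<^sub>v x = A.U2 * A.S2 * transpose_mat A.V2 *\<^sub>v x"
    by (simp add: left_zero_vec[OF carrier_vecI])
  moreover have "spec_norm (A.U2 * A.S2 * transpose_mat A.V2) \<le> 1 * S $$ (i,i) * 1"
    by (intro spec_norm_mult_le A.spec_norm_S2) (use i A.spec_norm_blocks in auto)
  ultimately have upper: "vnorm (A *\<^sub>v x) \<le> S $$ (i,i)"
    using vnorm_mult_le[of x "A.U2 * A.S2 * transpose_mat A.V2"] nx by simp
  have "B = A + (B - A)" by (intro eq_matI) auto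
  then have "B *\<^sub>v x = A *\<^sub>v x + (B - A) *\<^sub>v x"
    using add_mult_mat_vec_dim[of A "B - A" x] by simp
  then have "vnorm (B *\<^sub>v x) \<le> vnorm (A *\<^sub>v x) + vnorm ((B - A) *\<^sub>v x)"
    using vnorm_triangle[of "A *\<^sub>v x" "(B - A) *\<^sub>v x"] by simp
  also have "\<dots> \<le> S $$ (i,i) + spec_norm (B - A)"
    using vnorm_mult_le[of x "B - A"] upper nx by simp
  finally show ?thesis using lower by simp
qed

text \<open>Multiplying the cross block V_2^T V'_1 by the leading diagonal of \<open>B\<close> turns
  V'_1 into B^T U'_1. Splitting B^T into A^T + (B - A)^T, the first part passes through the trailing
  block of \<open>A\<close> and leaves the cross block of left vectors.\<close>

lemma wedin_half:
  assumes A: "A \<in> carrier_mat n m" "is_svd A U S V" and B: "B \<in> carrier_mat n m" "is_svd B U' S' V'"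
    and r: "0 < r" "r < n" "r < m" and pos: "0 < S' $$ (r-1,r-1)"
  shows "S' $$ (r-1,r-1) * spec_norm (transpose_mat (tail_cols r V) * lead_cols r V') \<le>
    S $$ (r,r) * spec_norm (transpose_mat (tail_cols r U) * lead_cols r U') + spec_norm (B - A)"
proof -
  interpret A: svd_split A U S V n m r using A r by unfold_locales auto
  interpret B: svd_split B U' S' V' n m r using B r by unfold_locales auto
  let ?E = "B - A"
  have "transpose_mat A.V2 * B.V1 * B.S1 = transpose_mat A.V2 * transpose_mat B * B.U1"
    by (simp add: assoc_mult_mat_dim B.At_mult_U1 B.transpose_S1)
  also have "transpose_mat B = transpose_mat A + transpose_mat ?E"
    by (intro eq_matI) auto
  also have "transpose_mat A.V2 * (transpose_mat A + transpose_mat ?E) * B.U1 =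
      transpose_mat A.V2 * transpose_mat A * B.U1 + transpose_mat A.V2 * transpose_mat ?E * B.U1"
    by (simp add: mult_add_mat_dim add_mult_mat_dim)
  also have "transpose_mat A.V2 * transpose_mat A * B.U1 =
      transpose_mat A.S2 * (transpose_mat A.U2 * B.U1)"
    by (simp add: A.V2t_mult_At assoc_mult_mat_dim)
  finally have eq: "transpose_mat A.V2 * B.V1 * B.S1 =
      transpose_mat A.S2 * (transpose_mat A.U2 * B.U1) + transpose_mat A.V2 * transpose_mat ?E * B.U1" .
  have "S' $$ (r-1,r-1) * spec_norm (transpose_mat A.V2 * B.V1) \<le>
      spec_norm (transpose_mat A.V2 * B.V1 * B.S1)"
    by (rule spec_norm_mult_diagonal_ge[OF B.diagonal_blocks(1), of r])
       (use r pos B.S_antimono in \<open>auto simp: lead_block_def\<close>)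
  also have "\<dots> \<le> spec_norm (transpose_mat A.S2 * (transpose_mat A.U2 * B.U1)) +
      spec_norm (transpose_mat A.V2 * transpose_mat ?E * B.U1)"
    unfolding eq by (rule spec_norm_triangle) auto
  also have "spec_norm (transpose_mat A.S2 * (transpose_mat A.U2 * B.U1)) \<le>
      S $$ (r,r) * spec_norm (transpose_mat A.U2 * B.U1)"
    by (rule spec_norm_mult_le) (use A.spec_norm_S2 r in auto)
  also have "spec_norm (transpose_mat A.V2 * transpose_mat ?E * B.U1) \<le> 1 * spec_norm ?E * 1"
    by (intro spec_norm_mult_le) (use A.spec_norm_blocks B.spec_norm_blocks in auto)
  finally show ?thesis by simp
qed

text \<open>The half bound controls each cross block by the other one; applied to the pair and to
  its transposes, it closes up for the larger of the two.\<close>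

lemma wedin:
  assumes A: "A \<in> carrier_mat n m" "is_svd A U S V" and B: "B \<in> carrier_mat n m" "is_svd B U' S' V'"
    and r: "0 < r" "r < n" "r < m" and gap: "S $$ (r,r) < S' $$ (r-1,r-1)"
  defines "p \<equiv> spec_norm (transpose_mat (tail_cols r V) * lead_cols r V')"
    and "q \<equiv> spec_norm (transpose_mat (tail_cols r U) * lead_cols r U')"
  shows "(S' $$ (r-1,r-1) - S $$ (r,r)) * max p q \<le> spec_norm (B - A)"
proof -
  interpret A: svd_split A U S V n m r using A r by unfold_locales auto
  interpret B: svd_split B U' S' V' n m r using B r by unfold_locales auto
  have nonneg: "0 \<le> S $$ (r,r)" using A.S_nonneg r by simp
  have p: "S' $$ (r-1,r-1) * p \<le> S $$ (r,r) * q + spec_norm (B - A)"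
    unfolding p_def q_def using gap nonneg by (intro wedin_half[OF A B r]) simp
  have "transpose_mat B - transpose_mat A = transpose_mat (B - A)"
    by (intro eq_matI) auto
  then have q: "S' $$ (r-1,r-1) * q \<le> S $$ (r,r) * p + spec_norm (B - A)"
    using wedin_half[of "transpose_mat A" m n V "transpose_mat S" U "transpose_mat B" V' "transpose_mat S'" U' r]
      A B is_svd_transpose[OF A(2)] is_svd_transpose[OF B(2)] r gap nonneg
    unfolding p_def q_def by simp
  show ?thesis
    using p q mult_left_mono[OF max.cobounded1[of p q] nonneg]
      mult_left_mono[OF max.cobounded2[of q p] nonneg]
    by (cases "p \<le> q") (auto simp: max_def left_diff_distrib)
qed

text \<open>Wedin's gap mixes singular values of both matrices. By Weyl it differs from the gap of
  \<open>A\<close> by at most the perturbation, so it is at least half of that gap once the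
  perturbation is below half of it. This is the source of the factor 2.\<close>

lemma sin_theta_bound:
  assumes A: "A \<in> carrier_mat n m" "is_svd A U S V" and B: "B \<in> carrier_mat n m" "is_svd B U' S' V'"
    and r: "0 < r" "r < n" "r < m"
  defines "\<mu> \<equiv> (if S $$ (r-1,r-1) = S $$ (r,r) then 1
                 else min (2 * spec_norm (B - A) / (S $$ (r-1,r-1) - S $$ (r,r))) 1)"
  shows "spec_norm (transpose_mat (tail_cols r V) * lead_cols r V') \<le> \<mu>"
    and "spec_norm (transpose_mat (tail_cols r U') * lead_cols r U) \<le> \<mu>"
proof -
  interpret A: svd_split A U S V n m r using A r by unfold_locales auto
  interpret B: svd_split B U' S' V' n m r using B r by unfold_locales auto
  let ?p = "spec_norm (transpose_mat A.V2 * B.V1)" and ?q = "spec_norm (transpose_mat B.U2 * A.U1)"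
  let ?g = "S $$ (r-1,r-1) - S $$ (r,r)" and ?e = "spec_norm (B - A)"
  have one: "?p \<le> 1" "?q \<le> 1"
    using spec_norm_mult_le[of "transpose_mat A.V2" B.V1 1 1] A.spec_norm_blocks B.spec_norm_blocks
      spec_norm_mult_le[of "transpose_mat B.U2" A.U1 1 1] by simp_all
  have "?p \<le> \<mu> \<and> ?q \<le> \<mu>"
  proof (cases "2 * ?e < ?g")
    \<comment> \<open>A large perturbation or a vanishing gap: the minimum is 1, and a product of
      contractions is a contraction.\<close>
    case False
    have "S $$ (r,r) \<le> S $$ (r-1,r-1)" using A.S_antimono r by simp
    then have "\<mu> = 1" using False unfolding \<mu>_def by (auto simp: min_def field_simps)
    then show ?thesis using one by simp
  next
    case True
    have e: "0 \<le> ?e" by simp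
    then have g: "0 < ?g" using True by linarith
    have sym: "spec_norm (A - B) = ?e" by (rule spec_norm_minus_commute) simp_all
    have w1: "S $$ (r-1,r-1) \<le> S' $$ (r-1,r-1) + ?e"
      using weyl_singular_value[OF B A, of "r-1"] r sym by simp
    have w2: "S' $$ (r,r) \<le> S $$ (r,r) + ?e"
      using weyl_singular_value[OF A B, of r] r by simp
    have half: "x \<le> 2 * ?e / ?g" if "0 \<le> x" "d * x \<le> ?e" "?g / 2 \<le> d" for x d
    proof -
      have "?g / 2 * x \<le> ?e" using that mult_right_mono[of "?g / 2" d x] by linarith
      then show ?thesis using g by (simp add: field_simps)
    qed
    have "(S' $$ (r-1,r-1) - S $$ (r,r)) * ?p \<le> ?e"
    proof -
      have d: "S $$ (r,r) < S' $$ (r-1,r-1)" using True w1 e by linarith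
      have "(S' $$ (r-1,r-1) - S $$ (r,r)) * ?p \<le>
        (S' $$ (r-1,r-1) - S $$ (r,r)) * max ?p (spec_norm (transpose_mat A.U2 * B.U1))"
        using d by (intro mult_left_mono) auto
      then show ?thesis using wedin[OF A B r d] by linarith
    qed
    then have "?p \<le> 2 * ?e / ?g" using True w1 by (intro half) auto
    \<comment> \<open>The second cross block pairs trailing vectors of \<open>B\<close> with leading
      ones of \<open>A\<close>, so Wedin's bound is used with the two matrices exchanged.\<close>
    moreover have "(S $$ (r-1,r-1) - S' $$ (r,r)) * ?q \<le> ?e"
    proof -
      have d: "S' $$ (r,r) < S $$ (r-1,r-1)" using True w2 e by linarith
      have "(S $$ (r-1,r-1) - S' $$ (r,r)) * ?q \<le>
        (S $$ (r-1,r-1) - S' $$ (r,r)) * max (spec_norm (transpose_mat B.V2 * A.V1)) ?q"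
        using d by (intro mult_left_mono) auto
      then show ?thesis using wedin[OF B A r d] sym by linarith
    qed
    then have "?q \<le> 2 * ?e / ?g" using True w2 by (intro half) auto
    ultimately show ?thesis using one g by (simp add: \<mu>_def)
  qed
  then show "?p \<le> \<mu>" "?q \<le> \<mu>" by simp_all
qed

section \<open>Alignment of the embeddings\<close>

text \<open>Together with \<open>spec_norm_mono\<close> this lets a single inequality between vector
  norms settle both matrix norms.\<close>

lemma frob_norm_mono:
  assumes "\<And>v. v \<in> carrier_vec (dim_col M) \<Longrightarrow> vnorm (M *\<^sub>v v) \<le> vnorm (N *\<^sub>v v)"
    and "dim_col M = dim_col N"
  shows "frob_norm M \<le> frob_norm N"
proof (rule power2_le_imp_le)
  have "vnorm (col M j) \<le> vnorm (col N j)" if "j < dim_col N" for j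
    using assms(1)[of "unit_vec (dim_col N) j"] assms(2) that
      mult_unit_vec_eq_col[of j M] mult_unit_vec_eq_col[of j N] by simp
  then show "(frob_norm M)\<^sup>2 \<le> (frob_norm N)\<^sup>2"
    using assms(2) by (auto simp: frob_norm_sq_cols intro!: sum_mono power_mono)
qed simp

lemma spec_norm_mono:
  assumes "\<And>v. v \<in> carrier_vec (dim_col M) \<Longrightarrow> vnorm (M *\<^sub>v v) \<le> vnorm (N *\<^sub>v v)"
    and "dim_col M = dim_col N"
  shows "spec_norm M \<le> spec_norm N"
proof (rule spec_norm_le)
  fix v :: "real vec" assume v: "v \<in> carrier_vec (dim_col M)"
  then show "vnorm (M *\<^sub>v v) \<le> spec_norm N * vnorm v"
    using assms(1)[OF v] vnorm_mult_le[of v N] assms(2) by simp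
qed simp

text \<open>The witness is the orthogonal polar factor. If \<open>D\<close> is the diagonal of singular values of \<open>G\<close>,
  the claim is \<open>(1 - d)\<^sup>2 \<le> 1 - d\<^sup>2\<close> for \<open>0 \<le> d \<le> 1\<close>.\<close>

lemma contraction_near_orthogonal:
  assumes G: "G \<in> carrier_mat k k" "spec_norm G \<le> 1"
  obtains Q where "Q \<in> orth_mats k"
    "\<And>z. z \<in> carrier_vec k \<Longrightarrow> (vnorm ((G - Q) *\<^sub>v z))\<^sup>2 \<le> (vnorm z)\<^sup>2 - (vnorm (G *\<^sub>v z))\<^sup>2"
proof -
  obtain P D R where svd: "is_svd G P D R" using svd_exists by blast
  have gdim: "dim_row G = k" "dim_col G = k" using G by auto
  note F = is_svdD[OF svd, unfolded gdim]
  have diag: "diagonal_mat D" and nonneg: "\<And>i. i < k \<Longrightarrow> 0 \<le> D $$ (i,i)"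
    using F(2,11,12) by (auto simp: singular_diag_def)
  have Rt: "transpose_mat R \<in> orth_mats k" by (rule orth_mats_transpose[OF F(4)])
  have Rt': "transpose_mat (transpose_mat R) * transpose_mat R = 1\<^sub>m k"
    using Rt by (simp add: orth_mats_def)
  define Q where "Q = P * transpose_mat R"
  have Gv: "G *\<^sub>v v = P *\<^sub>v (D *\<^sub>v (transpose_mat R *\<^sub>v v))" if "dim_vec v = k" for v
  proof -
    have "P * D * transpose_mat R *\<^sub>v v = P *\<^sub>v (D *\<^sub>v (transpose_mat R *\<^sub>v v))"
      using F(7-12) that by (simp add: assoc_mult_mat_vec_dim)
    then show ?thesis by (simp only: F(1)[symmetric])
  qed
  \<comment> \<open>The contraction \<open>G\<close> is tested on its j-th right singular vector,
    the column \<open>R *\<^sub>v unit_vec k j\<close>.\<close>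
  have le_1: "D $$ (j,j) \<le> 1" if j: "j < k" for j
  proof -
    let ?e = "unit_vec k j :: real vec"
    have e: "vnorm ?e = 1" using j by (rule vnorm_unit_vec)
    have "transpose_mat R *\<^sub>v (R *\<^sub>v ?e) = transpose_mat R * R *\<^sub>v ?e"
      using F(7-12) by (intro assoc_mult_mat_vec_dim[symmetric]) auto
    also have "\<dots> = ?e" by (simp add: F(6))
    finally have "G *\<^sub>v (R *\<^sub>v ?e) = P *\<^sub>v (D *\<^sub>v ?e)"
      using Gv[of "R *\<^sub>v ?e"] F(7-12) by simp
    then have "vnorm (D *\<^sub>v ?e) = vnorm (G *\<^sub>v (R *\<^sub>v ?e))"
      using F(7-12) by (simp add: vnorm_isometry[OF F(5)])
    also have "\<dots> \<le> 1"
      using vnorm_mult_le[of "R *\<^sub>v ?e" G] F(7-12) G gdim e by (simp add: vnorm_isometry[OF F(6)])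
    finally have "(vnorm (D *\<^sub>v ?e))\<^sup>2 \<le> 1" by (simp add: power_le_one)
    moreover have "((D *\<^sub>v ?e) $ j)\<^sup>2 \<le> (vnorm (D *\<^sub>v ?e))\<^sup>2"
      unfolding vnorm_sq_sum using j F(11) by (intro member_le_sum) auto
    moreover have "(D *\<^sub>v ?e) $ j = D $$ (j,j)"
      using diagonal_mult_vec_index[OF diag, of ?e j] j F(11,12) by simp
    ultimately have "(D $$ (j,j))\<^sup>2 \<le> 1" by simp
    then show ?thesis by (simp add: abs_square_le_1)
  qed
  show ?thesis
  proof (rule that[of Q])
    show "Q \<in> orth_mats k" unfolding Q_def by (rule orth_mats_mult[OF F(3) Rt])
    fix z :: "real vec" assume "z \<in> carrier_vec k"
    then have z: "dim_vec z = k" by simp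
    define w where "w = transpose_mat R *\<^sub>v z"
    have w: "dim_vec w = k" using F(10) by (simp add: w_def)
    have nw: "vnorm z = vnorm w" using z by (simp add: w_def vnorm_isometry[OF Rt'])
    have Dw: "dim_vec (D *\<^sub>v w) = k" using F(11) by simp
    have nG: "vnorm (G *\<^sub>v z) = vnorm (D *\<^sub>v w)"
      using Gv[OF z] Dw by (simp add: w_def vnorm_isometry[OF F(5)])
    have "(G - Q) *\<^sub>v z = G *\<^sub>v z - Q *\<^sub>v z"
      using gdim z F(7-12)
      by (intro minus_mult_distrib_mat_vec[OF carrier_matI carrier_matI carrier_vecI]) (auto simp: Q_def)
    also have "Q *\<^sub>v z = P *\<^sub>v w"
      using F(7-12) z by (simp add: Q_def w_def assoc_mult_mat_vec_dim)
    also have "G *\<^sub>v z = P *\<^sub>v (D *\<^sub>v w)" using Gv[OF z] by (simp add: w_def)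
    also have "P *\<^sub>v (D *\<^sub>v w) - P *\<^sub>v w = P *\<^sub>v (D *\<^sub>v w - w)"
      using F(7-12) w
      by (intro mult_minus_distrib_mat_vec[symmetric, OF carrier_matI carrier_vecI carrier_vecI]) auto
    finally have "vnorm ((G - Q) *\<^sub>v z) = vnorm (D *\<^sub>v w - w)"
      using w by (simp add: vnorm_isometry[OF F(5)])
    then have "(vnorm ((G - Q) *\<^sub>v z))\<^sup>2 = (\<Sum>i<k. ((D *\<^sub>v w) $ i - w $ i)\<^sup>2)"
      using w F(11) by (simp add: vnorm_sq_sum del: index_mult_mat_vec)
    also have "\<dots> \<le> (\<Sum>i<k. (w $ i)\<^sup>2 - ((D *\<^sub>v w) $ i)\<^sup>2)"
    proof (rule sum_mono)
      fix i assume "i \<in> {..<k}"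
      then have i: "i < k" by simp
      let ?d = "D $$ (i,i)"
      have Dwi: "(D *\<^sub>v w) $ i = ?d * w $ i"
        using diagonal_mult_vec_index[OF diag, of w i] i w F(11,12) by simp
      have "0 \<le> 2 * (?d * (1 - ?d)) * (w $ i)\<^sup>2"
        using nonneg[OF i] le_1[OF i] by (intro mult_nonneg_nonneg) auto
      then show "((D *\<^sub>v w) $ i - w $ i)\<^sup>2 \<le> (w $ i)\<^sup>2 - ((D *\<^sub>v w) $ i)\<^sup>2"
        unfolding Dwi by (simp add: power2_eq_square algebra_simps)
    qed
    also have "\<dots> = (vnorm z)\<^sup>2 - (vnorm (G *\<^sub>v z))\<^sup>2"
      using w F(11) by (simp add: nw nG vnorm_sq_sum sum_subtractf del: index_mult_mat_vec)
    finally show "(vnorm ((G - Q) *\<^sub>v z))\<^sup>2 \<le> (vnorm z)\<^sup>2 - (vnorm (G *\<^sub>v z))\<^sup>2" .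
  qed
qed

section \<open>The two residuals of the alignment and their norms\<close>

locale svd_pair = A: svd_split A U S V n m r + B: svd_split "A + E" Ut St Vt n m r
  for A E U S V Ut St Vt :: "real mat" and n m r :: nat +
  assumes carrier_E: "E \<in> carrier_mat n m" and r_pos: "0 < r" and r_less: "r < n" "r < m"
begin

abbreviation "B \<equiv> A + E"

text \<open>Equal singular values need a case of their own: division by zero yields 0, so the
  minimum would be 0 instead of 1.\<close>

definition \<mu> :: real where
  "\<mu> = (if S $$ (r-1,r-1) = S $$ (r,r) then 1
        else min (2 * spec_norm E / (S $$ (r-1,r-1) - S $$ (r,r))) 1)"

lemma dim_E [simp]: "dim_row E = n" "dim_col E = m"
  using carrier_E by auto

lemma B_minus_A: "B - A = E"
  by (intro eq_matI) auto

lemma sin_theta: "spec_norm (transpose_mat A.V2 * B.V1) \<le> \<mu>" "spec_norm (transpose_mat B.U2 * A.U1) \<le> \<mu>"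
  using sin_theta_bound[OF A.carrier_A A.svd B.carrier_A B.svd r_pos r_less]
  unfolding B_minus_A \<mu>_def by simp_all

lemma \<mu>_le_1: "\<mu> \<le> 1" and \<mu>_nonneg: "0 \<le> \<mu>"
  using spec_norm_nonneg order_trans[OF _ sin_theta(1)] by (auto simp: \<mu>_def)

lemma sigma_nonneg: "0 \<le> S $$ (r,r)"
  using A.S_nonneg r_less by simp

text \<open>The residual Y - X G: the direct effect of \<open>E\<close>, and the part of the leading
  space of \<open>B\<close> that leaks into the trailing right singular space of
  \<open>A\<close>.\<close>

definition "R1 = E * B.V1 + A.U2 * (A.S2 * (transpose_mat A.V2 * B.V1))"

lemma B_mult_V1_eq: "B * B.V1 = A * A.V1 * (transpose_mat A.V1 * B.V1) + R1"
proof -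
  have "A * B.V1 = (A.U1 * A.S1 * transpose_mat A.V1 + A.U2 * A.S2 * transpose_mat A.V2) * B.V1"
    by (simp only: A.A_decomp[symmetric])
  also have "\<dots> = A * A.V1 * (transpose_mat A.V1 * B.V1) + A.U2 * (A.S2 * (transpose_mat A.V2 * B.V1))"
    by (simp add: add_mult_mat_dim assoc_mult_mat_dim flip: A.A_mult_V1)
  finally have "B * B.V1 = A * A.V1 * (transpose_mat A.V1 * B.V1)
      + A.U2 * (A.S2 * (transpose_mat A.V2 * B.V1)) + E * B.V1"
    by (simp add: add_mult_mat_dim)
  also have "\<dots> = A * A.V1 * (transpose_mat A.V1 * B.V1) + R1"
    unfolding R1_def by (intro eq_matI) auto
  finally show ?thesis .
qed

abbreviation "frE \<equiv> frob_norm (hard_threshold r E)"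
abbreviation "frS \<equiv> frob_norm (hard_threshold r A.S2)"

lemma frob_norm_S2_mult: "frob_norm (A.S2 * (transpose_mat A.V2 * B.V1)) \<le> frS * \<mu>"
  using frob_norm_mult_le_hard_threshold[of A.S2 "transpose_mat A.V2 * B.V1" r]
    mult_left_mono[OF sin_theta(1), of frS] by simp

lemma frob_norm_E_mult: "dim_row N = m \<Longrightarrow> dim_col N \<le> r \<Longrightarrow> spec_norm N \<le> 1 \<Longrightarrow> frob_norm (E * N) \<le> frE"
  using frob_norm_mult_le_hard_threshold[of E N r] mult_left_mono[of "spec_norm N" 1 frE] by simp

lemma frob_norm_Et_mult:
  "dim_row N = n \<Longrightarrow> dim_col N \<le> r \<Longrightarrow> spec_norm N \<le> 1 \<Longrightarrow> frob_norm (transpose_mat E * N) \<le> frE"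
  using frob_norm_transpose_mult_le_hard_threshold[of E N r] mult_left_mono[of "spec_norm N" 1 frE] by simp

lemma spec_norm_R1: "spec_norm R1 \<le> spec_norm E + S $$ (r,r) * \<mu>"
proof -
  have "spec_norm R1 \<le> spec_norm (E * B.V1) + spec_norm (A.U2 * (A.S2 * (transpose_mat A.V2 * B.V1)))"
    unfolding R1_def by (rule spec_norm_triangle) auto
  also have "spec_norm (E * B.V1) \<le> spec_norm E * 1"
    by (rule spec_norm_mult_le) (use B.spec_norm_blocks in auto)
  also have "spec_norm (A.U2 * (A.S2 * (transpose_mat A.V2 * B.V1))) \<le> 1 * (S $$ (r,r) * \<mu>)"
    by (intro spec_norm_mult_le A.spec_norm_S2 sin_theta) (use A.spec_norm_blocks r_less in auto)
  finally show ?thesis by simp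
qed

lemma frob_norm_R1: "frob_norm R1 \<le> frE + frS * \<mu>"
proof -
  have "frob_norm R1 \<le> frob_norm (E * B.V1) + frob_norm (A.U2 * (A.S2 * (transpose_mat A.V2 * B.V1)))"
    unfolding R1_def by (rule frob_norm_triangle) auto
  also have "frob_norm (E * B.V1) \<le> frE"
    using B.spec_norm_blocks by (intro frob_norm_E_mult) auto
  also have "frob_norm (A.U2 * (A.S2 * (transpose_mat A.V2 * B.V1))) \<le> frS * \<mu>"
    using frob_norm_S2_mult by (simp add: frob_norm_isometry[OF A.U_blocks(2)])
  finally show ?thesis by simp
qed

text \<open>This is the block W_2^T V_1 X^T of the overview without its last factor U_1^T, which is
  a contraction. Writing A^T as B^T - E^T in \<open>H_eq\<close> brings in the trailing block of
  \<open>B\<close>.\<close>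

definition "H = transpose_mat B.V2 * transpose_mat A * A.U1"

lemma H_eq: "H = transpose_mat B.V2 * transpose_mat B * A.U1 + - (transpose_mat B.V2 * transpose_mat E * A.U1)"
proof -
  have "transpose_mat B.V2 * transpose_mat B * A.U1 =
      H + transpose_mat B.V2 * transpose_mat E * A.U1"
    unfolding H_def by (simp add: transpose_add_dim mult_add_mat_dim add_mult_mat_dim)
  then show ?thesis by (intro eq_matI) (auto simp: H_def)
qed

text \<open>By Weyl the trailing block of \<open>B\<close> has norm at most sigma_{r+1} + |E|; it
  multiplies the second sine bound.\<close>

lemma spec_norm_H: "spec_norm H \<le> (S $$ (r,r) + spec_norm E) * \<mu> + spec_norm E"
proof -
  have "St $$ (r,r) \<le> S $$ (r,r) + spec_norm E"
    using weyl_singular_value[OF A.carrier_A A.svd B.carrier_A B.svd r_less] by (simp add: B_minus_A)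
  then have S2: "spec_norm B.S2 \<le> S $$ (r,r) + spec_norm E"
    using B.spec_norm_S2[OF r_less] by linarith
  have "spec_norm H \<le> spec_norm (transpose_mat B.V2 * transpose_mat B * A.U1)
      + spec_norm (- (transpose_mat B.V2 * transpose_mat E * A.U1))"
    unfolding H_eq by (rule spec_norm_triangle) auto
  also have "transpose_mat B.V2 * transpose_mat B * A.U1 = transpose_mat B.S2 * (transpose_mat B.U2 * A.U1)"
    by (simp add: B.V2t_mult_At assoc_mult_mat_dim)
  also have "spec_norm (transpose_mat B.S2 * (transpose_mat B.U2 * A.U1)) \<le> (S $$ (r,r) + spec_norm E) * \<mu>"
    by (intro spec_norm_mult_le sin_theta) (use S2 in auto)
  also have "spec_norm (- (transpose_mat B.V2 * transpose_mat E * A.U1)) \<le> 1 * spec_norm E * 1"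
    unfolding spec_norm_uminus
    by (intro spec_norm_mult_le) (use A.spec_norm_blocks B.spec_norm_blocks in auto)
  finally show ?thesis by simp
qed

text \<open>Splitting \<open>\<parallel>B\<^sup>T U\<^sub>1\<parallel>\<^sub>F\<close> along the right singular subspaces of \<open>B\<close> and
  \<open>\<parallel>B W\<^sub>1\<parallel>\<^sub>F\<close> along the left singular subspaces of \<open>A\<close> produces the same first summand, so
  Ky Fan's principle compares the second ones.\<close>

lemma frob_norm_VtB: "frob_norm (transpose_mat B.V2 * (transpose_mat B * A.U1)) \<le> frE + frS * \<mu>"
proof -
  have "frob_norm (transpose_mat B * A.U1) \<le> frob_norm (B * B.V1)"
    using A.spec_norm_blocks by (intro B.ky_fan_frob_norm) auto
  then have "(frob_norm (transpose_mat B * A.U1))\<^sup>2 \<le> (frob_norm (B * B.V1))\<^sup>2"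
    by (intro power_mono) auto
  moreover have "(frob_norm (transpose_mat B * A.U1))\<^sup>2 =
      (frob_norm (transpose_mat B.V1 * (transpose_mat B * A.U1)))\<^sup>2
      + (frob_norm (transpose_mat B.V2 * (transpose_mat B * A.U1)))\<^sup>2"
    by (rule frob_norm_resolution[OF B.V_blocks(3)]) auto
  moreover have "(frob_norm (B * B.V1))\<^sup>2 = (frob_norm (transpose_mat A.U1 * (B * B.V1)))\<^sup>2
      + (frob_norm (transpose_mat A.U2 * (B * B.V1)))\<^sup>2"
    by (rule frob_norm_resolution[OF A.U_blocks(3)]) auto
  moreover have "frob_norm (transpose_mat B.V1 * (transpose_mat B * A.U1)) =
      frob_norm (transpose_mat A.U1 * (B * B.V1))"
    using frob_norm_transpose[of "transpose_mat A.U1 * (B * B.V1)"]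
    by (simp add: transpose_mult_dim assoc_mult_mat_dim)
  ultimately have "(frob_norm (transpose_mat B.V2 * (transpose_mat B * A.U1)))\<^sup>2 \<le>
      (frob_norm (transpose_mat A.U2 * (B * B.V1)))\<^sup>2" by simp
  then have "frob_norm (transpose_mat B.V2 * (transpose_mat B * A.U1)) \<le>
      frob_norm (transpose_mat A.U2 * (B * B.V1))" by (rule power2_le_imp_le) simp
  also have "transpose_mat A.U2 * (B * B.V1) =
      transpose_mat A.U2 * A * B.V1 + transpose_mat A.U2 * (E * B.V1)"
    by (simp add: add_mult_mat_dim mult_add_mat_dim assoc_mult_mat_dim)
  also have "transpose_mat A.U2 * A * B.V1 = A.S2 * (transpose_mat A.V2 * B.V1)"
    by (simp add: A.U2t_mult_A assoc_mult_mat_dim)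
  also have "frob_norm (A.S2 * (transpose_mat A.V2 * B.V1) + transpose_mat A.U2 * (E * B.V1)) \<le>
      frob_norm (A.S2 * (transpose_mat A.V2 * B.V1)) + frob_norm (transpose_mat A.U2 * (E * B.V1))"
    by (rule frob_norm_triangle) auto
  also have "frob_norm (transpose_mat A.U2 * (E * B.V1)) \<le> frob_norm (E * B.V1)"
    using A.spec_norm_blocks by (intro frob_norm_contraction_left) auto
  also have "frob_norm (E * B.V1) \<le> frE"
    using B.spec_norm_blocks by (intro frob_norm_E_mult) auto
  finally show ?thesis using frob_norm_S2_mult by simp
qed

text \<open>Passing from \<open>B\<close> back to \<open>A\<close> adds one \<open>frE\<close>: the
  cross term with E^T has r columns and contractions on both sides.\<close>

lemma frob_norm_H: "frob_norm H \<le> frE + frS * \<mu> + frE"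
proof -
  have "frob_norm H \<le> frob_norm (transpose_mat B.V2 * transpose_mat B * A.U1)
      + frob_norm (- (transpose_mat B.V2 * transpose_mat E * A.U1))"
    unfolding H_eq by (rule frob_norm_triangle) auto
  also have "transpose_mat B.V2 * transpose_mat B * A.U1 = transpose_mat B.V2 * (transpose_mat B * A.U1)"
    by (simp add: assoc_mult_mat_dim)
  also have "frob_norm \<dots> \<le> frE + frS * \<mu>" by (rule frob_norm_VtB)
  also have "frob_norm (- (transpose_mat B.V2 * transpose_mat E * A.U1)) =
      frob_norm (transpose_mat B.V2 * (transpose_mat E * A.U1))"
    by (simp add: assoc_mult_mat_dim)
  also have "\<dots> \<le> frob_norm (transpose_mat E * A.U1)"
    using B.spec_norm_blocks by (intro frob_norm_contraction_left) auto
  also have "\<dots> \<le> frE"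
    using A.spec_norm_blocks by (intro frob_norm_Et_mult) auto
  finally show ?thesis by simp
qed

lemma alignment:
  obtains Q where "Q \<in> orth_mats r"
    "spec_norm (A * A.V1 - B * B.V1 * Q) \<le> spec_norm R1 + spec_norm H"
    "frob_norm (A * A.V1 - B * B.V1 * Q) \<le> frob_norm R1 + frob_norm H"
proof -
  let ?G = "transpose_mat A.V1 * B.V1" and ?X = "A * A.V1" and ?Y = "B * B.V1"
  let ?Gt = "transpose_mat B.V1 * A.V1"
  have Gt: "transpose_mat ?Gt = ?G" by (simp add: transpose_mult_dim)
  have "spec_norm ?Gt \<le> 1 * 1"
    by (rule spec_norm_mult_le) (use A.spec_norm_blocks B.spec_norm_blocks in auto)
  then obtain Q where Q: "Q \<in> orth_mats r" and near:
    "\<And>z. z \<in> carrier_vec r \<Longrightarrow> (vnorm ((?Gt - Q) *\<^sub>v z))\<^sup>2 \<le> (vnorm z)\<^sup>2 - (vnorm (?Gt *\<^sub>v z))\<^sup>2"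
    using contraction_near_orthogonal[of ?Gt r] by (auto simp: carrier_matI)
  have [simp]: "dim_row Q = r" "dim_col Q = r" and QQ: "transpose_mat Q * Q = 1\<^sub>m r"
    using Q by (auto simp: orth_mats_def)
  \<comment> \<open>The deviation X (G - Q^T) that arises from replacing \<open>?G\<close> by an
    orthogonal matrix.\<close>
  define R2 where "R2 = ?X * (?G - transpose_mat Q)"
  have [simp]: "dim_row R1 = n" "dim_col R1 = r" by (simp_all add: R1_def)
  have [simp]: "dim_row R2 = n" "dim_col R2 = r" by (simp_all add: R2_def)
  have [simp]: "dim_row H = m - r" "dim_col H = r" by (simp_all add: H_def)
  have "?X * transpose_mat Q * Q = ?X" by (simp add: assoc_mult_mat_dim QQ)
  moreover have "?Y = ?X * transpose_mat Q + (R1 + R2)"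
    unfolding B_mult_V1_eq R2_def by (subst mult_minus_mat_dim) (auto intro!: eq_matI)
  then have "?Y * Q = ?X * transpose_mat Q * Q + (R1 + R2) * Q"
    using add_mult_mat_dim[of "?X * transpose_mat Q" "R1 + R2" Q] by simp
  ultimately have "?Y * Q = ?X + (R1 + R2) * Q" by simp
  then have diff: "?X - ?Y * Q = - ((R1 + R2) * Q)"
    by (intro eq_matI) auto
  define K where "K = H * transpose_mat A.U1"
  \<comment> \<open>Since A^T U_1 = V_1 S_1^T, the product A^T U_1 U_1^T is V_1 X^T.\<close>
  have K: "K = transpose_mat B.V2 * (A.V1 * transpose_mat ?X)"
    unfolding K_def H_def
    by (simp add: A.A_mult_V1 transpose_mult_dim assoc_mult_mat_dim A.At_mult_U1
        assoc_mult_mat_dim[of "transpose_mat A" A.U1, symmetric])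
  \<comment> \<open>With z = X^T y, the defect |z|^2 - |G^T z|^2 that bounds the polar error is, by
    Pythagoras for the right singular vectors of \<open>B\<close>, the squared norm of the trailing
    component of V_1 z.\<close>
  have le: "vnorm (transpose_mat R2 *\<^sub>v y) \<le> vnorm (K *\<^sub>v y)" if y: "dim_vec y = n" for y
  proof (rule power2_le_imp_le)
    define z where "z = transpose_mat ?X *\<^sub>v y"
    have [simp]: "dim_vec z = r" by (simp add: z_def)
    have "transpose_mat R2 = (?Gt - Q) * transpose_mat ?X"
      by (simp add: R2_def transpose_mult_dim[of ?X "?G - transpose_mat Q"] transpose_minus_dim transpose_mult_dim[of "transpose_mat A.V1"])
    then have "(vnorm (transpose_mat R2 *\<^sub>v y))\<^sup>2 = (vnorm ((?Gt - Q) *\<^sub>v z))\<^sup>2"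
      using y by (simp add: z_def assoc_mult_mat_vec_dim[of "?Gt - Q" "transpose_mat ?X"])
    also have "\<dots> \<le> (vnorm z)\<^sup>2 - (vnorm (?Gt *\<^sub>v z))\<^sup>2"
      by (rule near) (simp add: carrier_vecI)
    also have "?Gt *\<^sub>v z = transpose_mat B.V1 *\<^sub>v (A.V1 *\<^sub>v z)"
      by (simp add: assoc_mult_mat_vec_dim)
    also have "vnorm z = vnorm (A.V1 *\<^sub>v z)"
      by (simp add: vnorm_isometry[OF A.V_blocks(1)])
    also have "(vnorm (A.V1 *\<^sub>v z))\<^sup>2 - (vnorm (transpose_mat B.V1 *\<^sub>v (A.V1 *\<^sub>v z)))\<^sup>2 =
        (vnorm (transpose_mat B.V2 *\<^sub>v (A.V1 *\<^sub>v z)))\<^sup>2"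
      using vnorm_resolution[OF B.V_blocks(3), of "A.V1 *\<^sub>v z"] by simp
    also have "transpose_mat B.V2 *\<^sub>v (A.V1 *\<^sub>v z) = K *\<^sub>v y"
      using y by (simp add: K z_def assoc_mult_mat_vec_dim)
    finally show "(vnorm (transpose_mat R2 *\<^sub>v y))\<^sup>2 \<le> (vnorm (K *\<^sub>v y))\<^sup>2" .
  qed simp
  have [simp]: "dim_col K = n" by (simp add: K_def)
  have "spec_norm (transpose_mat R2) \<le> spec_norm K" by (rule spec_norm_mono) (auto intro: le)
  also have "\<dots> \<le> spec_norm H * 1"
    unfolding K_def by (rule spec_norm_mult_le) (use A.spec_norm_blocks in auto)
  finally have spec: "spec_norm R2 \<le> spec_norm H" by simp
  have "frob_norm (transpose_mat R2) \<le> frob_norm K" by (rule frob_norm_mono) (auto intro: le)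
  also have "\<dots> \<le> frob_norm H"
    unfolding K_def by (rule frob_norm_contraction_right) (use A.spec_norm_blocks in auto)
  finally have frob: "frob_norm R2 \<le> frob_norm H" by simp
  have Q1: "spec_norm Q \<le> 1" by (rule spec_norm_isometry[OF QQ])
  show ?thesis
  proof (rule that[OF Q])
    have "spec_norm (?X - ?Y * Q) \<le> spec_norm (R1 + R2) * 1"
      unfolding diff spec_norm_uminus by (rule spec_norm_mult_le) (use Q1 in auto)
    also have "\<dots> \<le> spec_norm R1 + spec_norm R2" using spec_norm_triangle[of R1 R2] by simp
    finally show "spec_norm (?X - ?Y * Q) \<le> spec_norm R1 + spec_norm H" using spec by simp
    have "frob_norm (?X - ?Y * Q) \<le> frob_norm (R1 + R2)"
      unfolding diff frob_norm_uminus by (rule frob_norm_contraction_right) (use Q1 in auto)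
    also have "\<dots> \<le> frob_norm R1 + frob_norm R2" by (rule frob_norm_triangle) auto
    finally show "frob_norm (?X - ?Y * Q) \<le> frob_norm R1 + frob_norm H" using frob by simp
  qed
qed

end

section \<open>Assembly of the spectral and the Frobenius bound\<close>

theorem theorem3p19:
  fixes A E U S V Ut St Vt :: "real mat" and n m r :: nat
  assumes "A \<in> carrier_mat n m" and "E \<in> carrier_mat n m"
    and "1 \<le> r" and "r < min n m"
    and "is_svd A U S V" and "is_svd (A + E) Ut St Vt"
  defines "\<sigma> \<equiv> \<lambda>i. S $$ (i - 1, i - 1)"
  defines "\<mu> \<equiv> (if \<sigma> r = \<sigma> (r+1) then 1
                 else min (2 * spec_norm E / (\<sigma> r - \<sigma> (r+1))) 1)"
  defines "X \<equiv> lead_cols r U * lead_block r S"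
  defines "Xt \<equiv> lead_cols r Ut * lead_block r St"
  shows "Inf {spec_norm (X - Xt * Q) | Q. Q \<in> orth_mats r}
           \<le> 3 * spec_norm E + 3 * \<sigma> (r+1) * \<mu> \<and>
         Inf {frob_norm (X - Xt * Q) | Q. Q \<in> orth_mats r}
           \<le> sqrt (2 * (frob_norm (hard_threshold r E))^2
                   + 3 * (frob_norm (hard_threshold r E)
                          + frob_norm (hard_threshold r (trail_block r S)) * \<mu>)^2)
              + frob_norm (hard_threshold r E)
              + frob_norm (hard_threshold r (trail_block r S)) * \<mu>"
proof -
  interpret P: svd_pair A E U S V Ut St Vt n m r
    using assms(1-6) by unfold_locales auto
  have mu: "P.\<mu> = \<mu>" unfolding P.\<mu>_def \<mu>_def \<sigma>_def by simp
  have X: "X = A * P.A.V1" and Xt: "Xt = (A + E) * P.B.V1"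
    by (simp_all add: X_def Xt_def P.A.A_mult_V1 P.B.A_mult_V1)
  obtain Q where Q: "Q \<in> orth_mats r"
    and spec: "spec_norm (X - Xt * Q) \<le> spec_norm P.R1 + spec_norm P.H"
    and frob: "frob_norm (X - Xt * Q) \<le> frob_norm P.R1 + frob_norm P.H"
    unfolding X Xt by (rule P.alignment)
  let ?e = "spec_norm E" and ?s = "\<sigma> (r+1)"
  have s: "?s = S $$ (r,r)" by (simp add: \<sigma>_def)
  \<comment> \<open>The infimum is at most the value at the aligning \<open>Q\<close>, because norms
    are bounded below by 0.\<close>
  have "Inf {spec_norm (X - Xt * Q) | Q. Q \<in> orth_mats r} \<le> spec_norm (X - Xt * Q)"
    using Q by (intro cInf_lower) (auto intro!: bdd_belowI[of _ 0])
  also have "\<dots> \<le> (?e + ?s * \<mu>) + ((?s + ?e) * \<mu> + ?e)"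
    using spec P.spec_norm_R1 P.spec_norm_H unfolding mu s by linarith
  also have "\<dots> \<le> 3 * ?e + 3 * ?s * \<mu>"
  proof -
    \<comment> \<open>The residuals sum to 2 e + 2 s \<mu> + e \<mu>. The last term is at most e
      because \<mu> \<le> 1, and one more s \<mu> is nonnegative.\<close>
    have "?e * \<mu> \<le> ?e * 1" using P.\<mu>_le_1 by (intro mult_left_mono) (auto simp: mu)
    moreover have "0 \<le> ?s * \<mu>" using P.\<mu>_nonneg P.sigma_nonneg unfolding mu s by (rule mult_nonneg_nonneg[rotated])
    ultimately show ?thesis by (simp add: algebra_simps)
  qed
  finally have spec_bound:
    "Inf {spec_norm (X - Xt * Q) | Q. Q \<in> orth_mats r} \<le> 3 * ?e + 3 * ?s * \<mu>" .
  let ?a = "frob_norm (hard_threshold r E)"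
  let ?c = "?a + frob_norm (hard_threshold r (trail_block r S)) * \<mu>"
  \<comment> \<open>The right side minus the left side is (x - y)^2 + y^2.\<close>
  have "(x + y)\<^sup>2 \<le> 2 * x\<^sup>2 + 3 * y\<^sup>2" for x y :: real
    using zero_le_power2[of "x - y"] zero_le_power2[of y] unfolding power2_sum power2_diff by linarith
  then have "(?a + ?c)\<^sup>2 \<le> 2 * ?a\<^sup>2 + 3 * ?c\<^sup>2" .
  then have ac: "?a + ?c \<le> sqrt (2 * ?a\<^sup>2 + 3 * ?c\<^sup>2)" by (rule real_le_rsqrt)
  \<comment> \<open>The residuals give \<open>?c + (?c + ?a)\<close>. One \<open>?c\<close> is kept
    as the two separate summands outside the root, and \<open>?a + ?c\<close> goes below the
    root.\<close>
  have le: "y + (y + x) \<le> z + x + w" if "x + y \<le> z" "y = x + w" for w x y z :: real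
    using that by linarith
  have "Inf {frob_norm (X - Xt * Q) | Q. Q \<in> orth_mats r} \<le> frob_norm (X - Xt * Q)"
    using Q by (intro cInf_lower) (auto intro!: bdd_belowI[of _ 0])
  also have "\<dots> \<le> ?c + (?c + ?a)"
    using frob P.frob_norm_R1 P.frob_norm_H unfolding mu by linarith
  also have "\<dots> \<le> sqrt (2 * ?a\<^sup>2 + 3 * ?c\<^sup>2) + ?a
      + frob_norm (hard_threshold r (trail_block r S)) * \<mu>"
    using le[OF ac refl] .
  finally show ?thesis using spec_bound by blast
qed

end
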